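(* Let $R$ be a commutative ring, let $n$ be a positive integer, let $S=R[X_0,\ldots,X_n]_{\mathbb{Q}}$ and $X=\operatorname{Proj} S$. Then for every $m\in\mathbb{Q}$, $H^i(X,\mathcal{O}_X(m))=0$ if $0<i<n$.
   Context: $R[X_0,\ldots,X_n]_{\mathbb{Q}}$ is the ring of polynomials with rational degree: the union over $i\ge1$ of $R[X_0,X_0^{1/2},\ldots,X_0^{1/i},\ldots,X_n,X_n^{1/2},\ldots,X_n^{1/i}]$ with formally adjoined compatible roots; equivalently, the ring of finite $R$-linear combinations of monomials $X_0^{r_0}\cdots X_n^{r_n}$, $r_j\in\mathbb{Q}_{\ge0}$, with exponents adding under multiplication. It is graded by $\mathbb{Q}_{\ge 0}$: $S=\bigoplus_{d\in\mathbb{Q}_{\ge0}}S_d$, where $S_d$ is the $R$-span of monomials with $r_0+\cdots+r_n=d$ (and $S_d=0$ for $d<0$). $\operatorname{Proj} S$ is the set of homogeneous prime ideals of $S$ not containing $S_+=\bigoplus_{d>0}S_d$, with closed sets $V_+(I)=\{\mathfrak{p}: I\subseteq\mathfrak{p}\}$ for homogeneous ideals $I$, and with its scheme structure, for which the sets $D_+(f)$ ($f$ homogeneous of positive degree) of primes not containing $f$ are affine open, $D_+(f)=\operatorname{Spec}$ of the degree-zero part of $S_f$ (localization at $\{1,f,f^2,\ldots\}$). For $m\in\mathbb{Q}$, $S(m)$ is the $\mathbb{Q}$-graded $S$-module with $S(m)_d=S_{m+d}$ for $d\in\mathbb{Q}$, and $\mathcal{O}_X(m)$ is the associated quasi-coherent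 sheaf $\widetilde{S(m)}$ on $X$, whose sections over $D_+(f)$ are the degree-zero elements of $S(m)_f$, i.e. the degree-$m$ elements of $S_f$. Cohomology is sheaf cohomology, computed by the Čech complex of the affine cover $\{D_+(X_i)\}_{0\le i\le n}$. *)

theory Defs
  imports "HOL-Analysis.Analysis" "HOL-Algebra.Algebra" "HOL-Library.Poly_Mapping"
begin

section \<open>The ring of polynomials with rational degree\<close>

text \<open>
  An exponent vector \<open>(r\<^sub>0, r\<^sub>1, \<dots>)\<close> is a finitely supported function \<open>nat \<Rightarrow>\<^sub>0 rat\<close>, and a formal
  \<open>R\<close>-linear combination of monomials is a finitely supported function from exponent vectors to \<open>R\<close>,
  multiplied by convolution.  The sort \<open>{comm_ring, comm_monoid_mult}\<close> axiomatises exactly the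
  commutative rings with one; unlike \<open>comm_ring_1\<close> it does not exclude the zero ring.
\<close>

type_synonym 'a rpoly = "(nat \<Rightarrow>\<^sub>0 rat) \<Rightarrow>\<^sub>0 'a"

definition exponents :: "nat \<Rightarrow> (nat \<Rightarrow>\<^sub>0 rat) set" where
  "exponents n = {e. Poly_Mapping.keys e \<subseteq> {..n} \<and> (\<forall>i. 0 \<le> Poly_Mapping.lookup e i)}"

definition tdeg :: "(nat \<Rightarrow>\<^sub>0 rat) \<Rightarrow> rat" where
  "tdeg e = (\<Sum>i\<in>Poly_Mapping.keys e. Poly_Mapping.lookup e i)"

definition ratpoly :: "nat \<Rightarrow> 'a::{comm_ring,comm_monoid_mult} rpoly ring" where
  "ratpoly n = \<lparr>carrier = {f. Poly_Mapping.keys f \<subseteq> exponents n}, monoid.mult = (*),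
                monoid.one = Poly_Mapping.single 0 1, ring.zero = 0, ring.add = (+)\<rparr>"

definition Xvar :: "nat \<Rightarrow> 'a::{comm_ring,comm_monoid_mult} rpoly" where
  "Xvar i = Poly_Mapping.single (Poly_Mapping.single i 1) 1"

definition homog_part :: "nat \<Rightarrow> rat \<Rightarrow> 'a::{comm_ring,comm_monoid_mult} rpoly set" where
  "homog_part n d = {f \<in> carrier (ratpoly n). \<forall>e\<in>Poly_Mapping.keys f. tdeg e = d}"

definition homogeneous :: "nat \<Rightarrow> 'a::{comm_ring,comm_monoid_mult} rpoly set" where
  "homogeneous n = (\<Union>d. homog_part n d)"

definition homog_component :: "rat \<Rightarrow> 'a::{comm_ring,comm_monoid_mult} rpoly \<Rightarrow> 'a rpoly" where
  "homog_component d f =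
     (\<Sum>e\<in>{e\<in>Poly_Mapping.keys f. tdeg e = d}. Poly_Mapping.single e (Poly_Mapping.lookup f e))"

text \<open>The irrelevant ideal \<open>S\<^sub>+\<close>, the direct sum of the \<open>S\<^sub>d\<close> with \<open>d > 0\<close>.\<close>

definition irrelevant :: "nat \<Rightarrow> 'a::{comm_ring,comm_monoid_mult} rpoly set" where
  "irrelevant n = {f \<in> carrier (ratpoly n). \<forall>e\<in>Poly_Mapping.keys f. 0 < tdeg e}"

lemma ratpoly_simps [simp]:
  "monoid.mult (ratpoly n) = (*)" "monoid.one (ratpoly n) = Poly_Mapping.single 0 1"
  "ring.zero (ratpoly n) = 0" "ring.add (ratpoly n) = (+)"
  by (simp_all add: ratpoly_def)

lemma carrier_ratpoly: "f \<in> carrier (ratpoly n) \<longleftrightarrow> Poly_Mapping.keys f \<subseteq> exponents n"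
  by (simp add: ratpoly_def)

lemma exponents_add: "e \<in> exponents n \<Longrightarrow> e' \<in> exponents n \<Longrightarrow> e + e' \<in> exponents n"
  using keys_add[of e e'] by (fastforce simp: exponents_def lookup_add)

lemma zero_exponents: "0 \<in> exponents n"
  by (simp add: exponents_def)

lemma single_0_1_mult [simp]:
  "Poly_Mapping.single 0 1 * f = (f :: 'a::{comm_ring,comm_monoid_mult} rpoly)"
  unfolding mult_map_scale_conv_mult[symmetric] by (rule poly_mapping_eqI) (simp add: map.rep_eq when_def)

lemma mult_single_0_1 [simp]:
  "f * Poly_Mapping.single 0 1 = (f :: 'a::{comm_ring,comm_monoid_mult} rpoly)"
  using single_0_1_mult[of f] by (simp add: mult.commute)

lemma ratpoly_cring: "cring (ratpoly n :: 'a::{comm_ring,comm_monoid_mult} rpoly ring)"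
proof (rule cringI)
  let ?S = "ratpoly n :: 'a rpoly ring"
  show "abelian_group ?S"
  proof (rule abelian_groupI)
    fix x y assume "x \<in> carrier ?S" "y \<in> carrier ?S"
    then show "x \<oplus>\<^bsub>?S\<^esub> y \<in> carrier ?S"
      using keys_add[of x y] by (auto simp: carrier_ratpoly)
  next
    fix x assume "x \<in> carrier ?S"
    then have "- x \<in> carrier ?S" by (simp add: carrier_ratpoly keys_def)
    then show "\<exists>y\<in>carrier ?S. y \<oplus>\<^bsub>?S\<^esub> x = \<zero>\<^bsub>?S\<^esub>"
      by (auto intro!: bexI[of _ "- x"])
  qed (auto simp: carrier_ratpoly ac_simps)
  show "comm_monoid ?S"
  proof (rule comm_monoidI)
    fix x y assume "x \<in> carrier ?S" "y \<in> carrier ?S"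
    then show "x \<otimes>\<^bsub>?S\<^esub> y \<in> carrier ?S"
      using keys_mult[of x y] exponents_add by (fastforce simp: carrier_ratpoly)
  qed (auto simp: carrier_ratpoly ac_simps zero_exponents)
qed (simp add: distrib_right)


section \<open>Proj as a topological space\<close>

definition homog_ideal :: "nat \<Rightarrow> 'a::{comm_ring,comm_monoid_mult} rpoly set \<Rightarrow> bool" where
  "homog_ideal n I \<longleftrightarrow> ideal I (ratpoly n) \<and> (\<forall>f\<in>I. \<forall>d. homog_component d f \<in> I)"

definition Proj :: "nat \<Rightarrow> 'a::{comm_ring,comm_monoid_mult} rpoly set set" where
  "Proj n = {\<pp>. homog_ideal n \<pp> \<and> primeideal \<pp> (ratpoly n) \<and> \<not> irrelevant n \<subseteq> \<pp>}"

definition Vplus :: "nat \<Rightarrow> 'a::{comm_ring,comm_monoid_mult} rpoly set \<Rightarrow> 'a rpoly set set" where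
  "Vplus n I = {\<pp> \<in> Proj n. I \<subseteq> \<pp>}"

definition Dplus :: "nat \<Rightarrow> 'a::{comm_ring,comm_monoid_mult} rpoly \<Rightarrow> 'a rpoly set set" where
  "Dplus n f = {\<pp> \<in> Proj n. f \<notin> \<pp>}"

definition Proj_topology :: "nat \<Rightarrow> 'a::{comm_ring,comm_monoid_mult} rpoly set topology" where
  "Proj_topology n = topology (\<lambda>U. \<exists>I. homog_ideal n I \<and> U = Proj n - Vplus n I)"

lemma homog_ideal_Inter:
  assumes "\<I> \<noteq> {}" "\<And>I. I \<in> \<I> \<Longrightarrow> homog_ideal n I"
  shows "homog_ideal n (\<Inter>\<I>)"
proof -
  interpret cring "ratpoly n" by (rule ratpoly_cring)
  show ?thesis
    using assms i_Intersect[of \<I>] by (auto simp: homog_ideal_def)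
qed

lemma homog_ideal_carrier:
  "homog_ideal n (carrier (ratpoly n :: 'a::{comm_ring,comm_monoid_mult} rpoly ring))"
proof -
  interpret cring "ratpoly n :: 'a rpoly ring" by (rule ratpoly_cring)
  have "homog_component d f \<in> carrier (ratpoly n)" if "f \<in> carrier (ratpoly n)" for d and f :: "'a rpoly"
  proof -
    have "Poly_Mapping.keys (homog_component d f) \<subseteq> Poly_Mapping.keys f"
      unfolding homog_component_def
      by (rule order_trans[OF keys_sum]) (auto split: if_splits)
    then show ?thesis using that by (auto simp: carrier_ratpoly)
  qed
  then show ?thesis by (simp add: homog_ideal_def oneideal)
qed

lemma istopology_Proj:
  "istopology (\<lambda>U :: 'a::{comm_ring,comm_monoid_mult} rpoly set set. \<exists>I. homog_ideal n I \<and> U = Proj n - Vplus n I)"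
  unfolding istopology_def
proof (intro conjI allI impI)
  fix U V :: "'a rpoly set set"
  assume "\<exists>I. homog_ideal n I \<and> U = Proj n - Vplus n I"
    and "\<exists>I. homog_ideal n I \<and> V = Proj n - Vplus n I"
  then obtain I J where I: "homog_ideal n I" "U = Proj n - Vplus n I"
    and J: "homog_ideal n J" "V = Proj n - Vplus n J" by blast
  have "Vplus n (I \<inter> J) = Vplus n I \<union> Vplus n J"
  proof -
    have False if p: "\<pp> \<in> Proj n" "I \<inter> J \<subseteq> \<pp>" "\<not> I \<subseteq> \<pp>" "\<not> J \<subseteq> \<pp>" for \<pp>
    proof -
      interpret p: primeideal \<pp> "ratpoly n" using p by (simp add: Proj_def)
      interpret I: ideal I "ratpoly n" using I by (simp add: homog_ideal_def)
      interpret J: ideal J "ratpoly n" using J by (simp add: homog_ideal_def)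
      obtain a b where "a \<in> I" "a \<notin> \<pp>" "b \<in> J" "b \<notin> \<pp>" using p by blast
      moreover from this have "a * b \<in> I \<inter> J"
        using I.I_r_closed[of a b] J.I_l_closed[of b a] I.Icarr J.Icarr by auto
      ultimately show False
        using p p.I_prime[of a b] I.Icarr J.Icarr by auto
    qed
    then show ?thesis by (auto simp: Vplus_def)
  qed
  moreover have "homog_ideal n (I \<inter> J)"
    using homog_ideal_Inter[of "{I, J}"] I J by auto
  ultimately show "\<exists>K. homog_ideal n K \<and> U \<inter> V = Proj n - Vplus n K"
    using I J by (intro exI[of _ "I \<inter> J"]) auto
next
  fix \<K> :: "'a rpoly set set set"
  assume "\<forall>U\<in>\<K>. \<exists>I. homog_ideal n I \<and> U = Proj n - Vplus n I"
  then obtain I where I: "\<And>U. U \<in> \<K> \<Longrightarrow> homog_ideal n (I U) \<and> U = Proj n - Vplus n (I U)"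
    by metis
  define H where "H = \<Inter>{J. homog_ideal n J \<and> (\<Union>U\<in>\<K>. I U) \<subseteq> J}"
  have "I U \<subseteq> carrier (ratpoly n)" if "U \<in> \<K>" for U
  proof -
    interpret ideal "I U" "ratpoly n" using I[OF that] by (simp add: homog_ideal_def)
    show ?thesis by (rule a_subset)
  qed
  then have "homog_ideal n H"
    unfolding H_def using homog_ideal_carrier[of n] by (intro homog_ideal_Inter) auto
  moreover have "\<Union>\<K> = Proj n - Vplus n H"
  proof -
    have "H \<subseteq> \<pp> \<longleftrightarrow> (\<forall>U\<in>\<K>. I U \<subseteq> \<pp>)" if "\<pp> \<in> Proj n" for \<pp>
      using that unfolding H_def Proj_def by blast
    moreover have "\<Union>\<K> = (\<Union>U\<in>\<K>. Proj n - Vplus n (I U))" using I by auto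
    ultimately show ?thesis by (auto simp: Vplus_def)
  qed
  ultimately show "\<exists>J. homog_ideal n J \<and> \<Union>\<K> = Proj n - Vplus n J" by blast
qed

lemma openin_Proj_topology:
  "openin (Proj_topology n) U \<longleftrightarrow> (\<exists>I. homog_ideal n I \<and> U = Proj n - Vplus n I)"
  unfolding Proj_topology_def by (simp add: istopology_Proj)


section \<open>The sheaf associated with a graded module, and the twists of the structure sheaf\<close>

text \<open>
  A graded module is given here by its pieces \<open>M d\<close>, which in the case at hand are subsets of \<open>S\<close>.
  The stalk of the associated sheaf at \<open>\<pp>\<close> is the degree-zero part of the localization of the module
  at the homogeneous elements outside \<open>\<pp>\<close>: the fractions \<open>a/s\<close> with \<open>a \<in> M d\<close> and \<open>s \<in> S\<^sub>d\<close>.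
\<close>

definition twist :: "nat \<Rightarrow> rat \<Rightarrow> rat \<Rightarrow> 'a::{comm_ring,comm_monoid_mult} rpoly set" where
  "twist n m d = homog_part n (m + d)"

type_synonym 'a fraction_class = "('a rpoly \<times> 'a rpoly) set"

definition fractions ::
  "nat \<Rightarrow> (rat \<Rightarrow> 'a::{comm_ring,comm_monoid_mult} rpoly set) \<Rightarrow> 'a rpoly set \<Rightarrow> ('a rpoly \<times> 'a rpoly) set"
where
  "fractions n M \<pp> = (\<Union>d. M d \<times> (homog_part n d - \<pp>))"

definition fraction_rel ::
  "nat \<Rightarrow> (rat \<Rightarrow> 'a::{comm_ring,comm_monoid_mult} rpoly set) \<Rightarrow> 'a rpoly set
     \<Rightarrow> (('a rpoly \<times> 'a rpoly) \<times> ('a rpoly \<times> 'a rpoly)) set"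
where
  "fraction_rel n M \<pp> = {((a, s), (b, t)). (a, s) \<in> fractions n M \<pp> \<and> (b, t) \<in> fractions n M \<pp> \<and>
                          (\<exists>u \<in> homogeneous n - \<pp>. u * (a * t - b * s) = 0)}"

definition stalk ::
  "nat \<Rightarrow> (rat \<Rightarrow> 'a::{comm_ring,comm_monoid_mult} rpoly set) \<Rightarrow> 'a rpoly set \<Rightarrow> 'a fraction_class set"
where
  "stalk n M \<pp> = fractions n M \<pp> // fraction_rel n M \<pp>"

definition fraction ::
  "nat \<Rightarrow> (rat \<Rightarrow> 'a::{comm_ring,comm_monoid_mult} rpoly set) \<Rightarrow> 'a rpoly set
     \<Rightarrow> 'a rpoly \<Rightarrow> 'a rpoly \<Rightarrow> 'a fraction_class"
where
  "fraction n M \<pp> a s = fraction_rel n M \<pp> `` {(a, s)}"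

definition stalk_add ::
  "nat \<Rightarrow> (rat \<Rightarrow> 'a::{comm_ring,comm_monoid_mult} rpoly set) \<Rightarrow> 'a rpoly set
     \<Rightarrow> 'a fraction_class \<Rightarrow> 'a fraction_class \<Rightarrow> 'a fraction_class"
where
  "stalk_add n M \<pp> x y = (\<Union>(a, s)\<in>x. \<Union>(b, t)\<in>y. fraction n M \<pp> (a * t + b * s) (s * t))"

text \<open>
  Sections over \<open>U\<close> are the families of germs that are locally given by one fraction.  As in
  \<open>HOL-Homology\<close>, additive groups are written as multiplicative records.
\<close>

definition assoc_sheaf ::
  "nat \<Rightarrow> (rat \<Rightarrow> 'a::{comm_ring,comm_monoid_mult} rpoly set) \<Rightarrow> 'a rpoly set set
     \<Rightarrow> ('a rpoly set \<Rightarrow> 'a fraction_class) monoid"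
where
  "assoc_sheaf n M U =
     \<lparr>carrier = {\<sigma> \<in> (\<Pi>\<^sub>E \<pp>\<in>U. stalk n M \<pp>).
        \<forall>\<pp>\<in>U. \<exists>V. openin (Proj_topology n) V \<and> \<pp> \<in> V \<and> V \<subseteq> U \<and>
          (\<exists>d. \<exists>a\<in>M d. \<exists>s\<in>homog_part n d. \<forall>\<qq>\<in>V. s \<notin> \<qq> \<and> \<sigma> \<qq> = fraction n M \<qq> a s)},
      monoid.mult = (\<lambda>\<sigma> \<tau>. \<lambda>\<pp>\<in>U. stalk_add n M \<pp> (\<sigma> \<pp>) (\<tau> \<pp>)),
      one = (\<lambda>\<pp>\<in>U. fraction n M \<pp> 0 (Poly_Mapping.single 0 1))\<rparr>"

definition O_twist ::
  "nat \<Rightarrow> rat \<Rightarrow> 'a::{comm_ring,comm_monoid_mult} rpoly set set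
     \<Rightarrow> ('a rpoly set \<Rightarrow> 'a fraction_class) monoid"
where
  "O_twist n m = assoc_sheaf n (twist n m)"


section \<open>Cech cohomology\<close>

text \<open>
  \<open>F\<close> is a sheaf of abelian groups whose sections over \<open>U\<close> are functions on \<open>U\<close>, with restriction of
  functions as restriction maps, and \<open>U j\<close> for \<open>j \<in> N\<close> is a family of open sets.  An increasing
  sequence \<open>i\<^sub>0 < \<dots> < i\<^sub>p\<close> in \<open>N\<close> is encoded by the set of its members; the position of \<open>j\<close> in the
  sequence of a set \<open>J\<close> is then \<open>card {i\<in>J. i < j}\<close>.
\<close>

definition cech_index :: "nat set \<Rightarrow> nat \<Rightarrow> nat set set" where
  "cech_index N p = {J. J \<subseteq> N \<and> finite J \<and> card J = Suc p}"

definition cech_cochains ::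
  "nat set \<Rightarrow> ('x set \<Rightarrow> ('x \<Rightarrow> 'v) monoid) \<Rightarrow> (nat \<Rightarrow> 'x set) \<Rightarrow> nat \<Rightarrow> (nat set \<Rightarrow> 'x \<Rightarrow> 'v) monoid"
where
  "cech_cochains N F U p = product_group (cech_index N p) (\<lambda>J. F (\<Inter>j\<in>J. U j))"

definition cech_coboundary ::
  "nat set \<Rightarrow> ('x set \<Rightarrow> ('x \<Rightarrow> 'v) monoid) \<Rightarrow> (nat \<Rightarrow> 'x set) \<Rightarrow> nat
     \<Rightarrow> (nat set \<Rightarrow> 'x \<Rightarrow> 'v) \<Rightarrow> (nat set \<Rightarrow> 'x \<Rightarrow> 'v)"
where
  "cech_coboundary N F U p c =
     (\<lambda>J\<in>cech_index N (Suc p).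
        finprod (F (\<Inter>j\<in>J. U j))
          (\<lambda>j. restrict (c (J - {j})) (\<Inter>j\<in>J. U j)
                 [^]\<^bsub>F (\<Inter>j\<in>J. U j)\<^esub> ((-1) ^ card {i\<in>J. i < j} :: int)) J)"

definition cech_cocycles ::
  "nat set \<Rightarrow> ('x set \<Rightarrow> ('x \<Rightarrow> 'v) monoid) \<Rightarrow> (nat \<Rightarrow> 'x set) \<Rightarrow> nat \<Rightarrow> (nat set \<Rightarrow> 'x \<Rightarrow> 'v) set"
where
  "cech_cocycles N F U p =
     kernel (cech_cochains N F U p) (cech_cochains N F U (Suc p)) (cech_coboundary N F U p)"

definition cech_coboundaries ::
  "nat set \<Rightarrow> ('x set \<Rightarrow> ('x \<Rightarrow> 'v) monoid) \<Rightarrow> (nat \<Rightarrow> 'x set) \<Rightarrow> nat \<Rightarrow> (nat set \<Rightarrow> 'x \<Rightarrow> 'v) set"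
where
  "cech_coboundaries N F U p =
     (case p of 0 \<Rightarrow> {\<one>\<^bsub>cech_cochains N F U 0\<^esub>}
      | Suc q \<Rightarrow> cech_coboundary N F U q ` carrier (cech_cochains N F U q))"

definition cech_cohomology ::
  "nat set \<Rightarrow> ('x set \<Rightarrow> ('x \<Rightarrow> 'v) monoid) \<Rightarrow> (nat \<Rightarrow> 'x set) \<Rightarrow> nat
     \<Rightarrow> (nat set \<Rightarrow> 'x \<Rightarrow> 'v) set monoid"
where
  "cech_cohomology N F U p =
     (cech_cochains N F U p)\<lparr>carrier := cech_cocycles N F U p\<rparr> Mod cech_coboundaries N F U p"

text \<open>
  The cohomology of \<open>\<O>\<^sub>X(m)\<close> on \<open>X = Proj S\<close>, computed by the cover \<open>D\<^sub>+(X\<^sub>0), \<dots>, D\<^sub>+(X\<^sub>n)\<close>.  Its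
  members are affine open with affine intersections and \<open>\<O>\<^sub>X(m)\<close> is quasi-coherent, so this is sheaf
  cohomology.
\<close>

definition Proj_cohomology ::
  "nat \<Rightarrow> nat \<Rightarrow> rat
     \<Rightarrow> (nat set \<Rightarrow> 'a::{comm_ring,comm_monoid_mult} rpoly set \<Rightarrow> 'a fraction_class) set monoid"
where
  "Proj_cohomology i n m = cech_cohomology {..n} (O_twist n m) (\<lambda>j. Dplus n (Xvar j)) i"

end

theory Submission
  imports Defs
begin

text \<open>
  Sections of \<open>\<O>\<^sub>X(m)\<close> over \<open>D\<^sub>+(X\<^sub>J)\<close>, where \<open>X\<^sub>J\<close> is the product of the \<open>X\<^sub>j\<close> with \<open>j \<in> J\<close>, are the Laurent
  polynomials of degree \<open>m\<close> whose exponents may be negative only at coordinates in \<open>J\<close>.  Hence the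
  Cech complex splits into one complex for each exponent vector \<open>e\<close>, in which only the \<open>J\<close> containing all
  coordinates with \<open>e\<^sub>j < 0\<close> occur.  If some coordinate \<open>v \<le> n\<close> has \<open>e\<^sub>v \<ge> 0\<close>, then inserting \<open>v\<close> into \<open>J\<close>
  is a contracting homotopy in positive degrees; if there is none, the only \<open>J\<close> is \<open>{..n}\<close>, which lives
  in degree \<open>n\<close>.

  Finite covers are avoided in the computation of sections.  Given a section \<open>\<sigma>\<close> that is \<open>b/t\<close> where \<open>t\<close> is
  invertible, the homogeneous elements \<open>x\<close> such that some power of \<open>t\<close> kills \<open>t \<sigma> - b\<close> at all points where
  \<open>x\<close> is invertible form an ideal, and this ideal lies in no point of \<open>D\<^sub>+(X\<^sub>J)\<close>, so it contains a power of
  \<open>X\<^sub>J\<close>.  Thus some \<open>t\<^sup>N\<^sup>+\<^sup>1 \<sigma>\<close> is a Laurent polynomial, and the same argument applied to the ideal of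
  denominators of \<open>\<sigma>\<close> shows that some \<open>X\<^sub>J\<^sup>k \<sigma>\<close> is one.
\<close>

subsection \<open>Homogeneous components\<close>

lemma tdeg_superset:
  assumes "finite A" "Poly_Mapping.keys e \<subseteq> A"
  shows "tdeg e = (\<Sum>i\<in>A. Poly_Mapping.lookup e i)"
  unfolding tdeg_def using assms by (intro sum.mono_neutral_left) (auto simp: in_keys_iff)

lemma tdeg_add: "tdeg (e + e') = tdeg e + tdeg e'"
proof -
  let ?A = "Poly_Mapping.keys e \<union> Poly_Mapping.keys e'"
  have "Poly_Mapping.keys (e + e') \<subseteq> ?A" by (rule keys_add)
  then show ?thesis
    using tdeg_superset[of ?A e] tdeg_superset[of ?A e'] tdeg_superset[of ?A "e + e'"]
    by (simp add: lookup_add sum.distrib)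
qed

lemma tdeg_0 [simp]: "tdeg 0 = 0"
  by (simp add: tdeg_def)

lemma lookup_homog_component:
  "Poly_Mapping.lookup (homog_component d f) e = (if tdeg e = d then Poly_Mapping.lookup f e else 0)"
proof -
  have "Poly_Mapping.lookup (homog_component d f) e
      = (\<Sum>k\<in>{k\<in>Poly_Mapping.keys f. tdeg k = d}. if k = e then Poly_Mapping.lookup f k else 0)"
    unfolding homog_component_def lookup_sum by (rule sum.cong) (auto simp: lookup_single when_def)
  also have "\<dots> = (if tdeg e = d then Poly_Mapping.lookup f e else 0)"
    by (subst sum.delta) (auto simp: in_keys_iff)
  finally show ?thesis .
qed

lemma keys_homog_component:
  "Poly_Mapping.keys (homog_component d f) = {e \<in> Poly_Mapping.keys f. tdeg e = d}"
  by (auto simp: in_keys_iff lookup_homog_component split: if_splits)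

lemma homog_component_add:
  "homog_component d (f + g) = homog_component d f + homog_component d g"
  by (rule poly_mapping_eqI) (simp add: lookup_homog_component lookup_add)

lemma homog_component_0 [simp]: "homog_component d 0 = 0"
  by (rule poly_mapping_eqI) (simp add: lookup_homog_component)

lemma homog_component_sum:
  "homog_component d (sum f A) = (\<Sum>i\<in>A. homog_component d (f i))"
  by (induction A rule: infinite_finite_induct) (simp_all add: homog_component_add)

text \<open>Unlike \<open>homog_part\<close>, this puts no sign condition on exponents, so it also
  grades Laurent polynomials; \<open>0\<close> has every degree.\<close>

definition of_degree :: "rat \<Rightarrow> 'a::{comm_ring,comm_monoid_mult} rpoly \<Rightarrow> bool" where
  "of_degree d f \<longleftrightarrow> (\<forall>e\<in>Poly_Mapping.keys f. tdeg e = d)"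

lemma of_degree_homog_component [simp]: "of_degree d (homog_component d f)"
  by (simp add: of_degree_def keys_homog_component)

lemma homog_component_of_degree:
  "of_degree d f \<Longrightarrow> homog_component d' f = (if d' = d then f else 0)"
  by (rule poly_mapping_eqI) (auto simp: of_degree_def lookup_homog_component in_keys_iff)

lemma of_degree_0 [simp]: "of_degree d 0"
  by (simp add: of_degree_def)

lemma of_degree_one [simp]: "of_degree 0 (Poly_Mapping.single 0 1)"
  by (simp add: of_degree_def)

lemma of_degree_add: "of_degree d f \<Longrightarrow> of_degree d g \<Longrightarrow> of_degree d (f + g)"
  using keys_add[of f g] by (auto simp: of_degree_def)

lemma of_degree_diff: "of_degree d f \<Longrightarrow> of_degree d g \<Longrightarrow> of_degree d (f - g)"
  using keys_diff[of f g] by (auto simp: of_degree_def)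

lemma of_degree_mult:
  assumes "of_degree d f" "of_degree d' g"
  shows "of_degree (d + d') (f * g)"
  using keys_mult[of f g] assms by (force simp: of_degree_def tdeg_add)

lemma sum_homog_components:
  fixes f :: "'a::{comm_ring,comm_monoid_mult} rpoly"
  assumes "finite D" "tdeg ` Poly_Mapping.keys f \<subseteq> D"
  shows "(\<Sum>d\<in>D. homog_component d f) = f"
proof (rule poly_mapping_eqI)
  fix e
  have "Poly_Mapping.lookup (\<Sum>d\<in>D. homog_component d f) e
      = (\<Sum>d\<in>D. if d = tdeg e then Poly_Mapping.lookup f e else 0)"
    unfolding lookup_sum by (rule sum.cong) (auto simp: lookup_homog_component)
  also have "\<dots> = Poly_Mapping.lookup f e"
  proof (cases "tdeg e \<in> D")
    case False
    then have "e \<notin> Poly_Mapping.keys f" using assms by blast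
    then show ?thesis using assms False by (simp add: in_keys_iff sum.delta)
  qed (simp add: assms sum.delta)
  finally show "Poly_Mapping.lookup (\<Sum>d\<in>D. homog_component d f) e = Poly_Mapping.lookup f e" .
qed

text \<open>A homogeneous factor only shifts degrees, so extracting components commutes with it.
  This keeps annihilators, sums \<open>p + (a)\<close> and ideals of denominators
  homogeneous.\<close>

lemma homog_component_mult:
  fixes f g :: "'a::{comm_ring,comm_monoid_mult} rpoly"
  assumes "of_degree d' g"
  shows "homog_component (d + d') (f * g) = homog_component d f * g"
proof -
  \<comment> \<open>\<open>d\<close> is inserted so that the sum contains the surviving index even
    when \<open>f\<close> has no term of degree \<open>d\<close>.\<close>
  let ?D = "insert d (tdeg ` Poly_Mapping.keys f)"
  have "homog_component (d + d') (homog_component k f * g) = (if k = d then homog_component d f * g else 0)" for k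
    using homog_component_of_degree[OF of_degree_mult[OF of_degree_homog_component[of k f] assms], of "d + d'"]
    by auto
  then have "homog_component (d + d') ((\<Sum>k\<in>?D. homog_component k f) * g) = homog_component d f * g"
    by (simp add: sum_distrib_right homog_component_sum del: sum.insert sum.insert_remove)
  then show ?thesis
    by (subst (asm) sum_homog_components) auto
qed

subsection \<open>Laurent polynomials\<close>

text \<open>For \<open>J \<subseteq> {..n}\<close> this is the localization of
  \<open>ratpoly n\<close> at the monomial X_J, realised inside \<open>rpoly\<close>, whose
  exponents may be negative; \<open>J = {}\<close> gives back the ring itself.\<close>

definition laurent :: "nat \<Rightarrow> nat set \<Rightarrow> 'a::{comm_ring,comm_monoid_mult} rpoly set" where
  "laurent n J = {f. \<forall>e\<in>Poly_Mapping.keys f. Poly_Mapping.keys e \<subseteq> {..n} \<and>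
                     (\<forall>i. i \<notin> J \<longrightarrow> 0 \<le> Poly_Mapping.lookup e i)}"

lemma carrier_ratpoly_laurent: "carrier (ratpoly n) = laurent n {}"
  by (auto simp: ratpoly_def laurent_def exponents_def)

lemma homog_part_laurent: "f \<in> homog_part n d \<longleftrightarrow> f \<in> laurent n {} \<and> of_degree d f"
  by (simp add: homog_part_def carrier_ratpoly_laurent of_degree_def)

lemma laurent_mono: "J \<subseteq> J' \<Longrightarrow> laurent n J \<subseteq> laurent n J'"
  by (auto simp: laurent_def)

lemma laurent_0 [simp]: "0 \<in> laurent n J"
  by (simp add: laurent_def)

lemma laurent_one [simp]: "Poly_Mapping.single 0 1 \<in> laurent n J"
  by (simp add: laurent_def)

lemma laurent_add: "f \<in> laurent n J \<Longrightarrow> g \<in> laurent n J \<Longrightarrow> f + g \<in> laurent n J"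
  using keys_add[of f g] by (auto simp: laurent_def)

lemma laurent_uminus: "f \<in> laurent n J \<Longrightarrow> - f \<in> laurent n J"
  by (simp add: laurent_def in_keys_iff)

lemma laurent_mult:
  assumes "f \<in> laurent n J" "g \<in> laurent n J"
  shows "f * g \<in> laurent n J"
proof -
  have "Poly_Mapping.keys (a + b) \<subseteq> {..n} \<and> (\<forall>i. i \<notin> J \<longrightarrow> 0 \<le> Poly_Mapping.lookup (a + b) i)"
    if "a \<in> Poly_Mapping.keys f" "b \<in> Poly_Mapping.keys g" for a b
  proof -
    have "Poly_Mapping.keys a \<subseteq> {..n}" "Poly_Mapping.keys b \<subseteq> {..n}"
      "\<And>i. i \<notin> J \<Longrightarrow> 0 \<le> Poly_Mapping.lookup a i" "\<And>i. i \<notin> J \<Longrightarrow> 0 \<le> Poly_Mapping.lookup b i"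
      using that assms by (simp_all add: laurent_def)
    moreover from this have "Poly_Mapping.keys (a + b) \<subseteq> {..n}" using keys_add[of a b] by blast
    ultimately show ?thesis by (simp add: lookup_add)
  qed
  then have "\<forall>e\<in>{a + b |a b. a \<in> Poly_Mapping.keys f \<and> b \<in> Poly_Mapping.keys g}.
      Poly_Mapping.keys e \<subseteq> {..n} \<and> (\<forall>i. i \<notin> J \<longrightarrow> 0 \<le> Poly_Mapping.lookup e i)"
    by fastforce
  then show ?thesis
    using keys_mult[of f g] unfolding laurent_def mem_Collect_eq by (meson subsetD)
qed

lemma laurent_homog_component: "f \<in> laurent n J \<Longrightarrow> homog_component d f \<in> laurent n J"
  by (auto simp: laurent_def keys_homog_component)

text \<open>\<open>mono_pow J r\<close> is \<open>X\<^sub>J\<^sup>r\<close>, where \<open>X\<^sub>J\<close> is the product of the \<open>X\<^sub>j\<close> with \<open>j \<in> J\<close>.\<close>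

definition mono_pow :: "nat set \<Rightarrow> rat \<Rightarrow> 'a::{comm_ring,comm_monoid_mult} rpoly" where
  "mono_pow J r = Poly_Mapping.single (\<Sum>j\<in>J. Poly_Mapping.single j r) 1"

lemma lookup_sum_single:
  assumes "finite J"
  shows "Poly_Mapping.lookup (\<Sum>j\<in>J. Poly_Mapping.single j r) i = (if i \<in> J then r else (0::rat))"
proof -
  have "Poly_Mapping.lookup (\<Sum>j\<in>J. Poly_Mapping.single j r) i = (\<Sum>j\<in>J. if j = i then r else 0)"
    unfolding lookup_sum by (rule sum.cong) (auto simp: lookup_single when_def)
  then show ?thesis using assms by (simp add: sum.delta)
qed

lemma mono_pow_0 [simp]: "mono_pow J 0 = Poly_Mapping.single 0 1"
  by (simp add: mono_pow_def)

lemma mono_pow_add: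
  "mono_pow J (r + s) = mono_pow J r * (mono_pow J s :: 'a::{comm_ring,comm_monoid_mult} rpoly)"
  by (simp add: mono_pow_def mult_single single_add sum.distrib)

text \<open>Negative exponents exist in \<open>rpoly\<close>, so X_J^r is a unit and can be
  cancelled even if the coefficient ring has zero divisors.\<close>

lemma mono_pow_inverse:
  "mono_pow J r * (mono_pow J (-r) * f) = (f :: 'a::{comm_ring,comm_monoid_mult} rpoly)"
proof -
  have "mono_pow J r * mono_pow J (-r) = (Poly_Mapping.single 0 1 :: 'a rpoly)"
    unfolding mono_pow_add[symmetric] by simp
  then show ?thesis by (simp flip: mult.assoc)
qed

lemma mono_pow_cancel:
  assumes "mono_pow J r * (f :: 'a::{comm_ring,comm_monoid_mult} rpoly) = mono_pow J r * g"
  shows "f = g"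
  using mono_pow_inverse[of J "-r" f] mono_pow_inverse[of J "-r" g] assms by simp

lemma keys_sum_single:
  assumes "finite J"
  shows "Poly_Mapping.keys (\<Sum>j\<in>J. Poly_Mapping.single j (r::rat)) \<subseteq> J"
proof
  fix i assume "i \<in> Poly_Mapping.keys (\<Sum>j\<in>J. Poly_Mapping.single j r)"
  then have "Poly_Mapping.lookup (\<Sum>j\<in>J. Poly_Mapping.single j r) i \<noteq> 0"
    by (rule in_keys_iff[THEN iffD1])
  then show "i \<in> J" using assms by (simp only: lookup_sum_single split: if_splits)
qed

lemma keys_mono_pow:
  "Poly_Mapping.keys (mono_pow J r :: 'a::{comm_ring,comm_monoid_mult} rpoly)
     \<subseteq> {\<Sum>j\<in>J. Poly_Mapping.single j r}"
  by (simp add: mono_pow_def)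

lemma mono_pow_laurent:
  assumes "finite J" "J \<subseteq> {..n}"
  shows "mono_pow J r \<in> laurent n J"
proof -
  have "Poly_Mapping.keys (\<Sum>j\<in>J. Poly_Mapping.single j r) \<subseteq> {..n}"
    using keys_sum_single[OF assms(1)] assms(2) by (rule subset_trans)
  then show ?thesis
    using keys_mono_pow[of J r] assms(1) by (auto simp: laurent_def lookup_sum_single)
qed

lemma mono_pow_ratpoly:
  assumes "finite J" "J \<subseteq> {..n}" "0 \<le> r"
  shows "mono_pow J r \<in> laurent n {}"
proof -
  have "Poly_Mapping.keys (\<Sum>j\<in>J. Poly_Mapping.single j r) \<subseteq> {..n}"
    using keys_sum_single[OF assms(1)] assms(2) by (rule subset_trans)
  then show ?thesis
    using keys_mono_pow[of J r] assms by (auto simp: laurent_def lookup_sum_single)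
qed

lemma of_degree_mono_pow:
  assumes "finite J"
  shows "of_degree (of_nat (card J) * r) (mono_pow J r)"
proof -
  have "tdeg (\<Sum>j\<in>J. Poly_Mapping.single j r) = of_nat (card J) * r"
    using tdeg_superset[OF assms keys_sum_single[OF assms, of r]]
    by (simp add: lookup_sum_single assms)
  then show ?thesis using keys_mono_pow[of J r] by (auto simp: of_degree_def)
qed

text \<open>Only finitely many exponents occur, so the negative ones have a common bound; the
  Archimedean property replaces this rational bound by a natural number \<open>k\<close>.\<close>

lemma laurent_clear_denominators:
  fixes f :: "'a::{comm_ring,comm_monoid_mult} rpoly"
  assumes "finite J" "J \<subseteq> {..n}" "f \<in> laurent n J"
  obtains k :: nat where "f * mono_pow J (of_nat k) \<in> laurent n {}"
proof -
  define B where "B = insert 0 ((\<lambda>(e, i). - Poly_Mapping.lookup e i) ` (Poly_Mapping.keys f \<times> J))"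
  have fin: "finite B" using assms by (simp add: B_def)
  obtain k :: nat where k: "Max B \<le> of_nat k" using real_arch_simple by blast
  have le: "- Poly_Mapping.lookup e i \<le> of_nat k" if "e \<in> Poly_Mapping.keys f" "i \<in> J" for e i
  proof -
    have "- Poly_Mapping.lookup e i \<in> B"
      unfolding B_def using that by (intro insertI2 image_eqI[of _ _ "(e, i)"]) simp_all
    then show ?thesis using Max_ge[OF fin] k by (meson order_trans)
  qed
  have "f * mono_pow J (of_nat k) \<in> laurent n J"
    using assms by (intro laurent_mult mono_pow_laurent)
  moreover have "0 \<le> Poly_Mapping.lookup e i"
    if e: "e \<in> Poly_Mapping.keys (f * mono_pow J (of_nat k))" and "i \<in> J" for e i
  proof -
    obtain e' b where e': "e' \<in> Poly_Mapping.keys f" "e = e' + b"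
        "b \<in> Poly_Mapping.keys (mono_pow J (of_nat k) :: 'a rpoly)"
      using subsetD[OF keys_mult e] by blast
    moreover have "b = (\<Sum>j\<in>J. Poly_Mapping.single j (of_nat k))"
      using subsetD[OF keys_mono_pow e'(3)] by simp
    ultimately show ?thesis
      using le[of e' i] \<open>i \<in> J\<close> assms(1) by (simp add: lookup_add lookup_sum_single)
  qed
  ultimately have "f * mono_pow J (of_nat k) \<in> laurent n {}"
    unfolding laurent_def mem_Collect_eq by metis
  then show ?thesis by (rule that)
qed

subsection \<open>Homogeneous ideals\<close>

text \<open>Translates ideals of the record \<open>ratpoly n\<close> into closure conditions on the
  operations of the type class. In the converse direction additive inverses come from multiplying by
  \<open>- Poly_Mapping.single 0 1\<close>.\<close>

lemma homog_ideal_iff: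
  fixes I :: "'a::{comm_ring,comm_monoid_mult} rpoly set"
  shows "homog_ideal n I \<longleftrightarrow> I \<subseteq> laurent n {} \<and> 0 \<in> I \<and> (\<forall>f\<in>I. \<forall>g\<in>I. f + g \<in> I) \<and>
     (\<forall>f\<in>I. \<forall>g\<in>laurent n {}. g * f \<in> I) \<and> (\<forall>f\<in>I. \<forall>d. homog_component d f \<in> I)"
    (is "?L = ?R")
proof
  interpret cring "ratpoly n :: 'a rpoly ring" by (rule ratpoly_cring)
  assume ?L
  then interpret I: ideal I "ratpoly n" by (simp add: homog_ideal_def)
  have "I \<subseteq> laurent n {}" "0 \<in> I"
    using I.a_subset I.zero_closed by (simp_all add: carrier_ratpoly_laurent)
  moreover have "f + g \<in> I" if "f \<in> I" "g \<in> I" for f g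
    using I.a_closed[OF that] by simp
  moreover have "g * f \<in> I" if "f \<in> I" "g \<in> laurent n {}" for f g
    using I.I_l_closed[of f g] that by (simp add: carrier_ratpoly_laurent)
  moreover have "\<forall>f\<in>I. \<forall>d. homog_component d f \<in> I"
    using \<open>?L\<close> unfolding homog_ideal_def by (rule conjunct2)
  ultimately show ?R by (intro conjI ballI) (simp_all del: split_paired_Ex)
next
  interpret cring "ratpoly n :: 'a rpoly ring" by (rule ratpoly_cring)
  assume R: ?R
  then have sub: "I \<subseteq> laurent n {}" and zero: "0 \<in> I" and add: "\<And>f g. f \<in> I \<Longrightarrow> g \<in> I \<Longrightarrow> f + g \<in> I"
    and mult: "\<And>f g. f \<in> I \<Longrightarrow> g \<in> laurent n {} \<Longrightarrow> g * f \<in> I"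
    by (simp_all only: simp_thms)
  from R have comp: "\<forall>f\<in>I. \<forall>d. homog_component d f \<in> I" by (elim conjE)
  have neg: "- f \<in> I" if "f \<in> I" for f
    using mult[OF that laurent_uminus[OF laurent_one]] by simp
  \<comment> \<open>The inverse in the record is characterised by uniqueness, so it has to be
    identified with the minus of the type class.\<close>
  have inv: "inv\<^bsub>add_monoid (ratpoly n)\<^esub> f \<in> I" if "f \<in> I" for f
  proof -
    have "f \<in> carrier (ratpoly n)" "- f \<in> carrier (ratpoly n)"
      unfolding carrier_ratpoly_laurent using subsetD[OF sub] that neg[OF that] by simp_all
    then have "a_inv (ratpoly n) f = - f"
      using minus_equality[of "- f" f] by simp
    then show ?thesis using neg[OF that] unfolding a_inv_def by metis
  qed
  have "subgroup I (add_monoid (ratpoly n))"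
  proof (rule subgroup.intro)
    show "I \<subseteq> carrier (add_monoid (ratpoly n))" using sub by (simp add: carrier_ratpoly_laurent)
    show "\<one>\<^bsub>add_monoid (ratpoly n)\<^esub> \<in> I" using zero by simp
    show "x \<otimes>\<^bsub>add_monoid (ratpoly n)\<^esub> y \<in> I" if "x \<in> I" "y \<in> I" for x y
      using add[OF that] by simp
  qed (rule inv)
  then have "ideal I (ratpoly n)"
  proof (rule idealI[OF ring_axioms])
    fix a x assume ax: "a \<in> I" "x \<in> carrier (ratpoly n :: 'a rpoly ring)"
    then show "x \<otimes>\<^bsub>ratpoly n\<^esub> a \<in> I" using mult by (simp add: carrier_ratpoly_laurent)
    then show "a \<otimes>\<^bsub>ratpoly n\<^esub> x \<in> I" by (simp add: mult.commute)
  qed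
  then show ?L using comp by (simp add: homog_ideal_def)
qed

lemma homog_idealD:
  assumes "homog_ideal n I"
  shows homog_ideal_subset: "I \<subseteq> laurent n {}"
    and homog_ideal_zero: "0 \<in> I"
    and homog_ideal_add: "\<And>f g. f \<in> I \<Longrightarrow> g \<in> I \<Longrightarrow> f + g \<in> I"
    and homog_ideal_mult: "\<And>f g. f \<in> I \<Longrightarrow> g \<in> laurent n {} \<Longrightarrow> g * f \<in> I"
    and homog_ideal_component: "\<And>f d. f \<in> I \<Longrightarrow> homog_component d f \<in> I"
  using assms unfolding homog_ideal_iff by simp_all

lemma homog_idealI:
  assumes "I \<subseteq> laurent n {}" "0 \<in> I" "\<And>f g. f \<in> I \<Longrightarrow> g \<in> I \<Longrightarrow> f + g \<in> I"
    "\<And>f g. f \<in> I \<Longrightarrow> g \<in> laurent n {} \<Longrightarrow> g * f \<in> I" "\<And>f d. f \<in> I \<Longrightarrow> homog_component d f \<in> I"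
  shows "homog_ideal n I"
  unfolding homog_ideal_iff by (intro conjI ballI allI assms)

lemma homog_ideal_diff:
  assumes "homog_ideal n I" "f \<in> I" "g \<in> I"
  shows "f - g \<in> I"
proof -
  have "(- Poly_Mapping.single 0 1) * g \<in> I"
    using assms(1,3) by (rule homog_ideal_mult[OF _ _ laurent_uminus[OF laurent_one]])
  then show ?thesis using homog_ideal_add[OF assms(1,2)] by force
qed

lemma homog_ideal_sum:
  assumes "homog_ideal n I" "\<And>i. i \<in> A \<Longrightarrow> f i \<in> I"
  shows "sum f A \<in> I"
  using assms(2)
  by (induction A rule: infinite_finite_induct)
     (simp_all add: homog_ideal_zero[OF assms(1)] homog_ideal_add[OF assms(1)])

text \<open>Used in contrapositive: an element outside \<open>I\<close>, being the sum of its
  components, has a component outside \<open>I\<close>.\<close>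

lemma homog_ideal_memI:
  assumes "homog_ideal n I" "\<And>d. homog_component d f \<in> I"
  shows "f \<in> I"
  using homog_ideal_sum[OF assms(1), of "tdeg ` Poly_Mapping.keys f" "\<lambda>d. homog_component d f"] assms(2)
  by (simp add: sum_homog_components)

text \<open>The unit is written \<open>Poly_Mapping.single 0 1\<close>, which makes sense over the
  zero ring as well.\<close>

primrec power_of :: "'a::{comm_ring,comm_monoid_mult} rpoly \<Rightarrow> nat \<Rightarrow> 'a rpoly" where
  "power_of g 0 = Poly_Mapping.single 0 1"
| "power_of g (Suc k) = g * power_of g k"

lemma power_of_add: "power_of g (k + l) = power_of g k * power_of g l"
  by (induction k) (simp_all add: mult.assoc)

lemma power_of_mult: "power_of (g * h) k = power_of g k * power_of h k"
  by (induction k) (simp_all add: mult.assoc mult.left_commute)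

lemma power_of_laurent: "g \<in> laurent n J \<Longrightarrow> power_of g k \<in> laurent n J"
  by (induction k) (simp_all add: laurent_mult)

lemma of_degree_power_of: "of_degree d g \<Longrightarrow> of_degree (of_nat k * d) (power_of g k)"
proof (induction k)
  case (Suc k)
  then show ?case using of_degree_mult[of d g "of_nat k * d" "power_of g k"]
    by (simp add: algebra_simps)
qed simp

text \<open>This is the ideal \<open>p + (a)\<close>. Since \<open>a\<close> has degree
  \<open>d\<close>, the component of \<open>y * a\<close> in degree \<open>d'\<close> is
  \<open>a\<close> times the component of \<open>y\<close> in degree \<open>d' - d\<close>.\<close>

lemma homog_ideal_adjoin:
  fixes p :: "'a::{comm_ring,comm_monoid_mult} rpoly set"
  assumes p: "homog_ideal n p" and a: "a \<in> laurent n {}" "of_degree d a"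
  shows "homog_ideal n {x + y * a |x y. x \<in> p \<and> y \<in> laurent n {}}"
proof (rule homog_idealI)
  let ?I = "{x + y * a |x y. x \<in> p \<and> y \<in> laurent n {}}"
  show "?I \<subseteq> laurent n {}"
    using homog_ideal_subset[OF p] a by (auto intro!: laurent_add laurent_mult)
  have "0 = 0 + 0 * a" by simp
  then show "0 \<in> ?I" using homog_ideal_zero[OF p] laurent_0 by blast
  fix f assume "f \<in> ?I"
  then obtain x y where f: "f = x + y * a" and x: "x \<in> p" and y: "y \<in> laurent n {}" by blast
  show "f + g \<in> ?I" if g: "g \<in> ?I" for g
  proof -
    obtain x' y' where g: "g = x' + y' * a" and x': "x' \<in> p" and y': "y' \<in> laurent n {}"
      using g by blast
    have "f + g = (x + x') + (y + y') * a" by (simp add: f g algebra_simps)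
    then show ?thesis using homog_ideal_add[OF p x x'] laurent_add[OF y y'] by blast
  qed
  show "g * f \<in> ?I" if "g \<in> laurent n {}" for g
  proof -
    have "g * f = g * x + (g * y) * a" by (simp add: f algebra_simps)
    then show ?thesis using homog_ideal_mult[OF p x that] laurent_mult[OF that y] by blast
  qed
  show "homog_component d' f \<in> ?I" for d'
  proof -
    have "homog_component d' (y * a) = homog_component (d' - d) y * a"
      using homog_component_mult[OF a(2), of "d' - d" y] by simp
    then have "homog_component d' f = homog_component d' x + homog_component (d' - d) y * a"
      by (simp add: f homog_component_add)
    then show ?thesis using homog_ideal_component[OF p x] laurent_homog_component[OF y] by blast
  qed
qed

text \<open>Primality of a homogeneous ideal can be tested on homogeneous elements, because the degrees
  are linearly ordered: if \<open>a, b\<close> lie outside the ideal, look at the product of their components of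
  largest degree outside the ideal.\<close>

lemma homog_prime_extend:
  fixes p :: "'a::{comm_ring,comm_monoid_mult} rpoly set"
  assumes p: "homog_ideal n p"
    and prime: "\<And>a b d e. a \<in> laurent n {} \<Longrightarrow> b \<in> laurent n {} \<Longrightarrow> of_degree d a \<Longrightarrow> of_degree e b
                 \<Longrightarrow> a * b \<in> p \<Longrightarrow> a \<in> p \<or> b \<in> p"
    and a: "a \<in> laurent n {}" and b: "b \<in> laurent n {}" and ab: "a * b \<in> p"
  shows "a \<in> p \<or> b \<in> p"
proof (rule ccontr)
  assume neg: "\<not> (a \<in> p \<or> b \<in> p)"
  have top: "\<exists>d. homog_component d f \<notin> p \<and> (\<forall>d'. homog_component d' f \<notin> p \<longrightarrow> d' \<le> d)"
    if "f \<notin> p" for f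
  proof -
    let ?D = "{d \<in> tdeg ` Poly_Mapping.keys f. homog_component d f \<notin> p}"
    have D: "d \<in> ?D" if "homog_component d f \<notin> p" for d
    proof -
      have "homog_component d f \<noteq> 0" using that homog_ideal_zero[OF p] by metis
      then have "Poly_Mapping.keys (homog_component d f) \<noteq> {}" by simp
      then show ?thesis using that by (auto simp: keys_homog_component)
    qed
    have fin: "finite ?D" by simp
    have ne: "?D \<noteq> {}"
    proof
      assume "?D = {}"
      then have "\<And>d. homog_component d f \<in> p" using D by blast
      then show False using homog_ideal_memI[OF p] that by metis
    qed
    have "homog_component (Max ?D) f \<notin> p" using Max_in[OF fin ne] by simp
    moreover have "\<forall>d'. homog_component d' f \<notin> p \<longrightarrow> d' \<le> Max ?D"
      using Max_ge[OF fin D] by simp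
    ultimately show ?thesis by (intro exI[of _ "Max ?D"] conjI)
  qed
  from neg have neg: "a \<notin> p" "b \<notin> p" by simp_all
  obtain d where d: "homog_component d a \<notin> p" "\<And>d'. d < d' \<Longrightarrow> homog_component d' a \<in> p"
    using top[OF neg(1)] by (metis not_le)
  obtain e where e: "homog_component e b \<notin> p" "\<And>e'. e < e' \<Longrightarrow> homog_component e' b \<in> p"
    using top[OF neg(2)] by (metis not_le)
  define A where "A = insert d (tdeg ` Poly_Mapping.keys a)"
  define B where "B = insert e (tdeg ` Poly_Mapping.keys b)"
  define t where "t = (\<lambda>(d', e'). homog_component (d + e) (homog_component d' a * homog_component e' b))"
  have fin: "finite (A \<times> B)" "(d, e) \<in> A \<times> B" by (simp_all add: A_def B_def)
  have "a * b = (\<Sum>d'\<in>A. homog_component d' a) * (\<Sum>e'\<in>B. homog_component e' b)"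
    using sum_homog_components[of A a] sum_homog_components[of B b] by (simp add: A_def B_def subset_insertI)
  also have "\<dots> = (\<Sum>(d', e')\<in>A \<times> B. homog_component d' a * homog_component e' b)"
    by (simp add: sum_product sum.cartesian_product)
  finally have "homog_component (d + e) (a * b) = sum t (A \<times> B)"
    by (simp add: homog_component_sum t_def case_prod_unfold)
  also have "\<dots> = t (d, e) + sum t (A \<times> B - {(d, e)})"
    using fin by (rule sum.remove)
  finally have eq: "t (d, e) = homog_component (d + e) (a * b) - sum t (A \<times> B - {(d, e)})"
    by simp
  have t: "t (d', e') = (if d' + e' = d + e then homog_component d' a * homog_component e' b else 0)" for d' e'
  proof -
    have "of_degree (d' + e') (homog_component d' a * homog_component e' b)"
      by (intro of_degree_mult of_degree_homog_component)
    from homog_component_of_degree[OF this, of "d + e"] show ?thesis by (simp add: t_def eq_commute)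
  qed
  have "t z \<in> p" if "z \<in> A \<times> B - {(d, e)}" for z
  proof -
    obtain d' e' where z: "z = (d', e')" by (cases z)
    then have ne: "d' \<noteq> d \<or> e' \<noteq> e" using that by auto
    \<comment> \<open>A pair of the wrong total degree contributes 0. Any other pair different from
      \<open>(d, e)\<close> exceeds the top degree in one factor, which then lies in
      \<open>p\<close>.\<close>
    consider "d' + e' \<noteq> d + e" | "d < d'" | "e < e'" using ne by linarith
    then show ?thesis
    proof cases
      case 1 then show ?thesis using homog_ideal_zero[OF p] by (simp add: z t)
    next
      case 2
      then have "homog_component d' a \<in> p" by (rule d(2))
      then have "homog_component e' b * homog_component d' a \<in> p"
        by (rule homog_ideal_mult[OF p _ laurent_homog_component[OF b]])
      then show ?thesis using homog_ideal_zero[OF p] by (simp add: z t mult.commute)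
    next
      case 3
      then have "homog_component e' b \<in> p" by (rule e(2))
      then have "homog_component d' a * homog_component e' b \<in> p"
        by (rule homog_ideal_mult[OF p _ laurent_homog_component[OF a]])
      then show ?thesis using homog_ideal_zero[OF p] by (simp add: z t)
    qed
  qed
  then have "t (d, e) \<in> p"
    unfolding eq by (intro homog_ideal_diff[OF p] homog_ideal_sum[OF p] homog_ideal_component[OF p ab])
  then have "homog_component d a * homog_component e b \<in> p" by (simp add: t)
  then have "homog_component d a \<in> p \<or> homog_component e b \<in> p"
    by (rule prime[OF laurent_homog_component[OF a] laurent_homog_component[OF b]
        of_degree_homog_component of_degree_homog_component])
  then show False using d(1) e(1) by simp
qed

section \<open>Points of Proj and powers inside homogeneous ideals\<close>

lemma ProjI:
  fixes p :: "'a::{comm_ring,comm_monoid_mult} rpoly set"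
  assumes p: "homog_ideal n p"
    and prime: "\<And>a b d e. a \<in> laurent n {} \<Longrightarrow> b \<in> laurent n {} \<Longrightarrow> of_degree d a \<Longrightarrow> of_degree e b
                 \<Longrightarrow> a * b \<in> p \<Longrightarrow> a \<in> p \<or> b \<in> p"
    and g: "g \<in> laurent n {}" "of_degree d g" "0 < d" "g \<notin> p"
  shows "p \<in> Proj n"
proof -
  interpret cring "ratpoly n :: 'a rpoly ring" by (rule ratpoly_cring)
  have "primeideal p (ratpoly n)"
  proof (rule primeidealI)
    show "ideal p (ratpoly n)" using p by (simp add: homog_ideal_def)
    show "carrier (ratpoly n) \<noteq> p" using g by (auto simp: carrier_ratpoly_laurent)
    show "a \<in> p \<or> b \<in> p"
      if "a \<in> carrier (ratpoly n)" "b \<in> carrier (ratpoly n)" "a \<otimes>\<^bsub>ratpoly n\<^esub> b \<in> p" for a b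
      by (rule homog_prime_extend[OF p]) (use that prime in \<open>simp_all add: carrier_ratpoly_laurent\<close>)
  qed (rule is_cring)
  \<comment> \<open>\<open>g\<close> serves twice: it shows that \<open>p\<close> is proper and that
    \<open>p\<close> does not contain the irrelevant ideal.\<close>
  moreover have "g \<in> irrelevant n"
    using g by (simp add: irrelevant_def carrier_ratpoly_laurent of_degree_def)
  ultimately show ?thesis using p g by (auto simp: Proj_def)
qed

text \<open>Homogeneous form of the description of radicals by primes: an ideal maximal among the
  homogeneous ones that contain \<open>I\<close> and no power of \<open>g\<close> is a point of
  D_+(g). It stands in for quasi-compactness of D_+(g) when passing from local to global.\<close>

lemma power_in_homog_ideal:
  fixes I :: "'a::{comm_ring,comm_monoid_mult} rpoly set"
  assumes I: "homog_ideal n I" and g: "g \<in> laurent n {}" "of_degree d g" "0 < d"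
    and nonzero: "\<And>p. p \<in> Proj n \<Longrightarrow> g \<notin> p \<Longrightarrow> \<not> I \<subseteq> p"
  shows "\<exists>k. power_of g k \<in> I"
proof (rule ccontr)
  assume neg: "\<nexists>k. power_of g k \<in> I"
  define \<A> where "\<A> = {p. homog_ideal n p \<and> I \<subseteq> p \<and> (\<forall>k. power_of g k \<notin> p)}"
  have "\<exists>p\<in>\<A>. \<forall>q\<in>\<A>. p \<subseteq> q \<longrightarrow> q = p"
  proof (rule subset_Zorn_nonempty)
    show "\<A> \<noteq> {}" using I neg by (auto simp: \<A>_def)
    fix \<C> assume C: "\<C> \<noteq> {}" "subset.chain \<A> \<C>"
    have ideals: "homog_ideal n p" if "p \<in> \<C>" for p
      using C(2) that by (auto simp: subset.chain_def \<A>_def)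
    have "homog_ideal n (\<Union>\<C>)"
    proof (rule homog_idealI)
      show "\<Union>\<C> \<subseteq> laurent n {}" using homog_ideal_subset[OF ideals] by (rule Union_least)
      show "0 \<in> \<Union>\<C>" using C(1) homog_ideal_zero[OF ideals] by (metis UnionI ex_in_conv)
    next
      fix f h assume fh: "f \<in> \<Union>\<C>" "h \<in> \<Union>\<C>"
      obtain p where p: "p \<in> \<C>" "f \<in> p" using fh(1) by (rule UnionE)
      obtain q where q: "q \<in> \<C>" "h \<in> q" using fh(2) by (rule UnionE)
      have "p \<subseteq> q \<or> q \<subseteq> p" using C(2) p(1) q(1) by (auto simp: subset.chain_def)
      then obtain r where "r \<in> \<C>" "f \<in> r" "h \<in> r" using p q by (metis subsetD)
      then show "f + h \<in> \<Union>\<C>" using homog_ideal_add[OF ideals] by (metis UnionI)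
    next
      fix f h :: "'a rpoly" assume "f \<in> \<Union>\<C>" "h \<in> laurent n {}"
      then show "h * f \<in> \<Union>\<C>" using homog_ideal_mult[OF ideals] by (metis Union_iff)
    next
      fix f d assume "f \<in> \<Union>\<C>"
      then show "homog_component d f \<in> \<Union>\<C>" using homog_ideal_component[OF ideals] by (metis Union_iff)
    qed
    moreover have "I \<subseteq> \<Union>\<C>"
    proof -
      obtain p where "p \<in> \<C>" using C(1) by auto
      moreover from this have "I \<subseteq> p" using C(2) by (auto simp: subset.chain_def \<A>_def)
      ultimately show ?thesis by blast
    qed
    moreover have "\<forall>k. power_of g k \<notin> \<Union>\<C>"
      using C(2) by (auto simp: subset.chain_def \<A>_def)
    ultimately show "\<Union>\<C> \<in> \<A>" by (simp add: \<A>_def)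
  qed
  then obtain p where "p \<in> \<A>" and max: "\<And>q. q \<in> \<A> \<Longrightarrow> p \<subseteq> q \<Longrightarrow> q = p" by (elim bexE) simp
  then have p: "homog_ideal n p" "I \<subseteq> p" "\<And>k. power_of g k \<notin> p" by (simp_all add: \<A>_def)
  \<comment> \<open>By maximality of \<open>p\<close>, the strictly larger ideal
    \<open>p + (a)\<close> contains a power of \<open>g\<close>.\<close>
  have adjoin: "\<exists>k x y. x \<in> p \<and> y \<in> laurent n {} \<and> power_of g k = x + y * a"
    if a: "a \<in> laurent n {}" "of_degree d a" "a \<notin> p" for a d
  proof (rule ccontr)
    assume contr: "\<nexists>k x y. x \<in> p \<and> y \<in> laurent n {} \<and> power_of g k = x + y * a"
    define J where "J = {x + y * a |x y. x \<in> p \<and> y \<in> laurent n {}}"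
    have mem: "x + y * a \<in> J" if "x \<in> p" "y \<in> laurent n {}" for x y
      using that unfolding J_def by blast
    have "p \<subseteq> J" using mem[OF _ laurent_0] by auto
    moreover have "homog_ideal n J" unfolding J_def using p(1) a(1,2) by (rule homog_ideal_adjoin)
    moreover have "\<forall>k. power_of g k \<notin> J" using contr unfolding J_def by blast
    ultimately have "J = p" using max[of J] p(2) by (auto simp: \<A>_def)
    moreover have "a \<in> J" using mem[OF homog_ideal_zero[OF p(1)] laurent_one] by simp
    ultimately show False using a(3) by simp
  qed
  have "p \<in> Proj n"
  proof (rule ProjI[OF p(1) _ g])
    show "g \<notin> p" using p(3)[of 1] by simp
    fix a b d e
    assume a: "a \<in> laurent n {}" "of_degree d a" and b: "b \<in> laurent n {}" "of_degree e b"
      and ab: "a * b \<in> p"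
    show "a \<in> p \<or> b \<in> p"
    proof (rule ccontr)
      assume "\<not> (a \<in> p \<or> b \<in> p)"
      then obtain k x y l x' y' where
        k: "x \<in> p" "y \<in> laurent n {}" "power_of g k = x + y * a" and
        l: "x' \<in> p" "y' \<in> laurent n {}" "power_of g l = x' + y' * b"
        using adjoin[OF a] adjoin[OF b] by metis
      \<comment> \<open>The product of the two expressions consists of multiples of
        \<open>x\<close>, \<open>x'\<close> and \<open>a * b\<close>, all of which lie in
        \<open>p\<close>.\<close>
      have "power_of g (k + l) = (x' + y' * b) * x + (y * a) * x' + (y * y') * (a * b)"
        unfolding power_of_add k(3) l(3) by (simp add: algebra_simps)
      also have "\<dots> \<in> p"
      proof (intro homog_ideal_add[OF p(1)])
        have "x' \<in> laurent n {}" using homog_ideal_subset[OF p(1)] l(1) by (rule subsetD)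
        then show "(x' + y' * b) * x \<in> p"
          by (intro homog_ideal_mult[OF p(1) k(1)] laurent_add laurent_mult l(2) b(1))
        show "y * a * x' \<in> p"
          by (intro homog_ideal_mult[OF p(1) l(1)] laurent_mult k(2) a(1))
        show "y * y' * (a * b) \<in> p"
          by (intro homog_ideal_mult[OF p(1) ab] laurent_mult k(2) l(2))
      qed
      finally show False using p(3) by simp
    qed
  qed
  then show False using nonzero[of p] p(2) p(3)[of 1] by simp
qed

lemma ProjD:
  fixes p :: "'a::{comm_ring,comm_monoid_mult} rpoly set"
  assumes "p \<in> Proj n"
  shows Proj_homog_ideal: "homog_ideal n p"
    and Proj_prime: "\<And>a b. a \<in> laurent n {} \<Longrightarrow> b \<in> laurent n {} \<Longrightarrow> a * b \<in> p \<Longrightarrow> a \<in> p \<or> b \<in> p"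
    and Proj_one: "Poly_Mapping.single 0 1 \<notin> p"
proof -
  show p: "homog_ideal n p" using assms by (simp add: Proj_def)
  interpret primeideal p "ratpoly n" using assms by (simp add: Proj_def)
  show "a \<in> p \<or> b \<in> p" if "a \<in> laurent n {}" "b \<in> laurent n {}" "a * b \<in> p" for a b
    using I_prime[of a b] that by (simp add: carrier_ratpoly_laurent)
  show "Poly_Mapping.single 0 1 \<notin> p"
  proof
    assume one: "Poly_Mapping.single 0 1 \<in> p"
    have "laurent n {} \<subseteq> p"
    proof
      fix f :: "'a rpoly" assume "f \<in> laurent n {}"
      then have "f * Poly_Mapping.single 0 1 \<in> p" by (rule homog_ideal_mult[OF p one])
      then show "f \<in> p" by simp
    qed
    then show False
      using I_notcarr homog_ideal_subset[OF p] by (simp add: carrier_ratpoly_laurent)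
  qed
qed

lemma Proj_notin_mult:
  assumes "p \<in> Proj n" "a \<in> laurent n {}" "b \<in> laurent n {}"
  shows "a * b \<notin> p \<longleftrightarrow> a \<notin> p \<and> b \<notin> p"
proof -
  have "a * b \<in> p" if "a \<in> p \<or> b \<in> p"
    using that homog_ideal_mult[OF Proj_homog_ideal[OF assms(1)]] assms(2,3)
    by (auto simp: mult.commute[of a b]) (metis mult.commute)
  then show ?thesis using Proj_prime[OF assms] by metis
qed

lemma Proj_notin_power_of:
  assumes "p \<in> Proj n" "a \<in> laurent n {}" "a \<notin> p"
  shows "power_of a k \<notin> p"
  by (induction k) (simp_all add: Proj_one[OF assms(1)] Proj_notin_mult[OF assms(1,2)] power_of_laurent assms)

lemma homogeneous_iff: "f \<in> homogeneous n \<longleftrightarrow> f \<in> laurent n {} \<and> (\<exists>d. of_degree d f)"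
  by (auto simp: homogeneous_def homog_part_laurent)

text \<open>The homogeneous elements outside a point form a multiplicative set, so the multipliers
  \<open>u\<close> that witness equalities of fractions can be combined.\<close>

lemma homogeneous_notin_mult:
  assumes "p \<in> Proj n" "a \<in> homogeneous n - p" "b \<in> homogeneous n - p"
  shows "a * b \<in> homogeneous n - p"
proof -
  from assms(2,3) have a: "a \<in> laurent n {}" "a \<notin> p" and b: "b \<in> laurent n {}" "b \<notin> p"
    by (simp_all add: homogeneous_iff)
  from assms(2,3) obtain d e where "of_degree d a" "of_degree e b" by (auto simp: homogeneous_iff)
  then have "of_degree (d + e) (a * b)" by (rule of_degree_mult)
  then show ?thesis
    using laurent_mult[OF a(1) b(1)] Proj_notin_mult[OF assms(1) a(1) b(1)] a b
    by (auto simp: homogeneous_iff)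
qed

lemma of_degree_nonneg:
  assumes "f \<in> laurent n {}" "of_degree d f" "f \<noteq> 0"
  shows "0 \<le> d"
proof -
  obtain e where "e \<in> Poly_Mapping.keys f" using assms(3) by (metis ex_in_conv keys_eq_empty)
  then have "tdeg e = d" "\<And>i. 0 \<le> Poly_Mapping.lookup e i"
    using assms(1,2) by (simp_all add: laurent_def of_degree_def)
  then show ?thesis by (simp add: tdeg_def sum_nonneg flip: \<open>tdeg e = d\<close>)
qed

lemma homog_ideal_annihilator:
  fixes y :: "'a::{comm_ring,comm_monoid_mult} rpoly"
  assumes "of_degree d y"
  shows "homog_ideal n {u \<in> laurent n {}. u * y = 0}"
proof (rule homog_idealI)
  fix f e assume "f \<in> {u \<in> laurent n {}. u * y = 0}"
  then show "homog_component e f \<in> {u \<in> laurent n {}. u * y = 0}"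
    using homog_component_mult[OF assms, of e f] by (simp add: laurent_homog_component)
qed (auto simp: laurent_add laurent_mult distrib_right mult.assoc)

text \<open>The last assumption says that the annihilator of \<open>y\<close> lies in no point of
  D_+(g), so it contains a power of \<open>g\<close>. The element \<open>y\<close> itself may have
  negative exponents.\<close>

lemma power_annihilates:
  fixes y :: "'a::{comm_ring,comm_monoid_mult} rpoly"
  assumes "of_degree e y" "g \<in> laurent n {}" "of_degree d g" "0 < d"
    and "\<And>p. p \<in> Proj n \<Longrightarrow> g \<notin> p \<Longrightarrow> \<exists>u\<in>homogeneous n - p. u * y = 0"
  shows "\<exists>k. power_of g k * y = 0"
proof -
  have "\<exists>k. power_of g k \<in> {u \<in> laurent n {}. u * y = 0}"
  proof (rule power_in_homog_ideal[OF homog_ideal_annihilator[OF assms(1)] assms(2-4)])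
    fix p assume "p \<in> Proj n" "g \<notin> p"
    then obtain u where "u \<in> homogeneous n - p" "u * y = 0" using assms(5) by blast
    then show "\<not> {u \<in> laurent n {}. u * y = 0} \<subseteq> p" by (auto simp: homogeneous_iff)
  qed
  then show ?thesis by blast
qed

subsection \<open>Germs of Laurent polynomials\<close>

lemma fractions_twist:
  "(a, s) \<in> fractions n (twist n m) p \<longleftrightarrow>
     a \<in> laurent n {} \<and> s \<in> laurent n {} \<and> s \<notin> p \<and> (\<exists>d. of_degree (m + d) a \<and> of_degree d s)"
  by (auto simp: fractions_def twist_def homog_part_laurent)

lemma fractions_twist_homogeneous:
  "(a, s) \<in> fractions n (twist n m) p \<Longrightarrow> s \<in> homogeneous n - p"
  by (auto simp: fractions_twist homogeneous_iff)

lemma mem_fraction: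
  "(b, t) \<in> fraction n M p a s \<longleftrightarrow> (a, s) \<in> fractions n M p \<and> (b, t) \<in> fractions n M p \<and>
     (\<exists>u\<in>homogeneous n - p. u * (a * t - b * s) = 0)"
  by (auto simp: fraction_def fraction_rel_def)

text \<open>The value of \<open>f\<close> in the stalk without a chosen denominator: all fractions
  \<open>a/s\<close> with \<open>a = f * s\<close> at \<open>p\<close>. The set is empty if
  \<open>f\<close> is not such a fraction at \<open>p\<close>; otherwise it is a single equivalence
  class.\<close>

definition germ ::
  "nat \<Rightarrow> rat \<Rightarrow> 'a::{comm_ring,comm_monoid_mult} rpoly \<Rightarrow> 'a rpoly set \<Rightarrow> 'a fraction_class"
where
  "germ n m f p = {(a, s) \<in> fractions n (twist n m) p. \<exists>u\<in>homogeneous n - p. u * (a - f * s) = 0}"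

lemma mem_germ:
  "(a, s) \<in> germ n m f p \<longleftrightarrow>
     (a, s) \<in> fractions n (twist n m) p \<and> (\<exists>u\<in>homogeneous n - p. u * (a - f * s) = 0)"
  by (simp add: germ_def)

text \<open>With \<open>ua\<close> and an analogous equation for \<open>b\<close>, cross
  multiplication eliminates \<open>f\<close>; for the converse, \<open>s\<close> joins the
  multiplier because it is invertible at \<open>p\<close>.\<close>

lemma germ_eq_fraction:
  fixes f :: "'a::{comm_ring,comm_monoid_mult} rpoly"
  assumes p: "p \<in> Proj n" and as: "(a, s) \<in> germ n m f p"
  shows "germ n m f p = fraction n (twist n m) p a s"
proof -
  from as obtain u where u: "u \<in> homogeneous n - p" "u * (a - f * s) = 0"
    and fr: "(a, s) \<in> fractions n (twist n m) p" by (auto simp: mem_germ)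
  note s = fractions_twist_homogeneous[OF fr]
  have ua: "u * a = u * (f * s)" using u(2) by (simp add: right_diff_distrib)
  have "(b, t) \<in> germ n m f p \<longleftrightarrow> (b, t) \<in> fraction n (twist n m) p a s" for b t
  proof
    assume "(b, t) \<in> germ n m f p"
    then obtain v where v: "v \<in> homogeneous n - p" "v * (b - f * t) = 0"
      and fr': "(b, t) \<in> fractions n (twist n m) p" by (auto simp: mem_germ)
    have vb: "v * b = v * (f * t)" using v(2) by (simp add: right_diff_distrib)
    have "u * v * (a * t - b * s) = v * t * (u * a) - u * s * (v * b)"
      by (simp add: algebra_simps)
    also have "\<dots> = 0" unfolding ua vb by (simp add: algebra_simps)
    finally show "(b, t) \<in> fraction n (twist n m) p a s"
      using homogeneous_notin_mult[OF p u(1) v(1)] fr fr' unfolding mem_fraction by blast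
  next
    assume "(b, t) \<in> fraction n (twist n m) p a s"
    then obtain v where v: "v \<in> homogeneous n - p" "v * (a * t - b * s) = 0"
      and fr': "(b, t) \<in> fractions n (twist n m) p" by (auto simp: mem_fraction)
    have vb: "v * (b * s) = v * (a * t)" using v(2) by (simp add: right_diff_distrib)
    have "(u * v * s) * (b - f * t) = u * (v * (b * s)) - v * t * (u * (f * s))"
      by (simp add: algebra_simps)
    also have "\<dots> = 0" unfolding ua[symmetric] vb by (simp add: algebra_simps)
    finally show "(b, t) \<in> germ n m f p"
      using homogeneous_notin_mult[OF p homogeneous_notin_mult[OF p u(1) v(1)] s] fr'
      unfolding mem_germ by blast
  qed
  then show ?thesis by (simp add: set_eq_iff split_paired_all)
qed

text \<open>\<open>stalk_add\<close> is a union over all pairs of representatives: every pair gives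
  the same class, and nonemptiness supplies at least one pair.\<close>

lemma stalk_add_germ:
  fixes f g :: "'a::{comm_ring,comm_monoid_mult} rpoly"
  assumes p: "p \<in> Proj n" and ne: "germ n m f p \<noteq> {}" "germ n m g p \<noteq> {}"
  shows "stalk_add n (twist n m) p (germ n m f p) (germ n m g p) = germ n m (f + g) p"
proof -
  have eq: "fraction n (twist n m) p (a * t + b * s) (s * t) = germ n m (f + g) p"
    if as: "(a, s) \<in> germ n m f p" and bt: "(b, t) \<in> germ n m g p" for a s b t
  proof -
    from as obtain u where u: "u \<in> homogeneous n - p" "u * (a - f * s) = 0"
      and fr: "(a, s) \<in> fractions n (twist n m) p" by (auto simp: mem_germ)
    from bt obtain v where v: "v \<in> homogeneous n - p" "v * (b - g * t) = 0"
      and fr': "(b, t) \<in> fractions n (twist n m) p" by (auto simp: mem_germ)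
    from fr obtain d where a: "a \<in> laurent n {}" "of_degree (m + d) a"
      and s: "s \<in> laurent n {}" "of_degree d s" "s \<notin> p"
      by (auto simp: fractions_twist)
    from fr' obtain e where b: "b \<in> laurent n {}" "of_degree (m + e) b"
      and t: "t \<in> laurent n {}" "of_degree e t" "t \<notin> p"
      by (auto simp: fractions_twist)
    have "of_degree (m + (d + e)) (a * t)" "of_degree (m + (d + e)) (b * s)"
      using of_degree_mult[OF a(2) t(2)] of_degree_mult[OF b(2) s(2)] by (simp_all add: ac_simps)
    then have "of_degree (m + (d + e)) (a * t + b * s)" by (rule of_degree_add)
    moreover have "of_degree (d + e) (s * t)" using s(2) t(2) by (rule of_degree_mult)
    ultimately have "(a * t + b * s, s * t) \<in> fractions n (twist n m) p"
      unfolding fractions_twist using a b s t Proj_notin_mult[OF p s(1) t(1)]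
      by (auto intro!: laurent_add laurent_mult)
    moreover have "(u * v) * ((a * t + b * s) - (f + g) * (s * t)) =
        v * t * (u * (a - f * s)) + u * s * (v * (b - g * t))"
      by (simp add: algebra_simps)
    then have "(u * v) * ((a * t + b * s) - (f + g) * (s * t)) = 0" by (simp add: u(2) v(2))
    ultimately have "(a * t + b * s, s * t) \<in> germ n m (f + g) p"
      using homogeneous_notin_mult[OF p u(1) v(1)] unfolding mem_germ by blast
    then show ?thesis by (rule germ_eq_fraction[OF p, symmetric])
  qed
  have "stalk_add n (twist n m) p (germ n m f p) (germ n m g p)
      = (\<Union>(a, s)\<in>germ n m f p. \<Union>(b, t)\<in>germ n m g p. germ n m (f + g) p)"
    unfolding stalk_add_def by (intro SUP_cong refl) (auto simp: eq)
  also have "\<dots> = germ n m (f + g) p" using ne by auto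
  finally show ?thesis .
qed

lemma germ_zero:
  assumes "p \<in> Proj n"
  shows "germ n m 0 p = fraction n (twist n m) p 0 (Poly_Mapping.single 0 1)"
proof (rule germ_eq_fraction[OF assms])
  have "(0, Poly_Mapping.single 0 1) \<in> fractions n (twist n m) p"
    using Proj_one[OF assms] by (auto simp: fractions_twist intro!: exI[of _ 0])
  moreover from this have "Poly_Mapping.single 0 1 \<in> homogeneous n - p"
    by (rule fractions_twist_homogeneous)
  ultimately show "(0, Poly_Mapping.single 0 1) \<in> germ n m 0 p" by (auto simp: mem_germ)
qed

section \<open>Basic open sets and the representatives of germs on them\<close>

definition D_mono :: "nat \<Rightarrow> nat set \<Rightarrow> 'a::{comm_ring,comm_monoid_mult} rpoly set set" where
  "D_mono n J = {p \<in> Proj n. mono_pow J 1 \<notin> p}"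

lemma mono_pow_insert:
  assumes "finite J" "j \<notin> J"
  shows "mono_pow (insert j J) r = mono_pow {j} r * (mono_pow J r :: 'a::{comm_ring,comm_monoid_mult} rpoly)"
  using assms by (simp add: mono_pow_def mult_single)

text \<open>Points are prime, so X_J avoids a point iff all its factors do. \<open>J\<close> has to
  be nonempty because the empty intersection is \<open>UNIV\<close> rather than
  \<open>Proj n\<close>.\<close>

lemma Inter_Dplus_eq_D_mono:
  assumes "finite J" "J \<noteq> {}" "J \<subseteq> {..n}"
  shows "(\<Inter>j\<in>J. Dplus n (Xvar j)) = (D_mono n J :: 'a::{comm_ring,comm_monoid_mult} rpoly set set)"
  using assms
proof (induction J rule: finite_ne_induct)
  case (singleton j)
  then show ?case by (simp add: Dplus_def D_mono_def Xvar_def mono_pow_def)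
next
  case (insert j J)
  have mem: "mono_pow {j} 1 \<in> laurent n {}" "mono_pow J 1 \<in> laurent n {}"
    using insert by (auto intro!: mono_pow_ratpoly)
  have X: "Xvar j = (mono_pow {j} 1 :: 'a rpoly)" by (simp add: Xvar_def mono_pow_def)
  have "(\<Inter>i\<in>insert j J. Dplus n (Xvar i)) = Dplus n (Xvar j) \<inter> (D_mono n J :: 'a rpoly set set)"
    using insert by simp
  also have "\<dots> = {p \<in> Proj n. mono_pow {j} 1 \<notin> p \<and> mono_pow J 1 \<notin> p}"
    unfolding D_mono_def Dplus_def X by (simp add: set_eq_iff conj_ac)
  also have "\<dots> = D_mono n (insert j J)"
    unfolding D_mono_def mono_pow_insert[OF insert(1,3)]
    by (intro Collect_cong conj_cong refl Proj_notin_mult[OF _ mem, symmetric])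
  finally show ?case .
qed

lemma power_of_mono_pow: "power_of (mono_pow J r) k = mono_pow J (of_nat k * r)"
  by (induction k) (simp_all add: distrib_right mono_pow_add)

lemma mono_pow_notin:
  assumes "finite J" "J \<subseteq> {..n}" "p \<in> D_mono n J"
  shows "mono_pow J (of_nat k) \<notin> p"
  using Proj_notin_power_of[of p n "mono_pow J 1" k] mono_pow_ratpoly[of J n 1] assms
  by (simp add: D_mono_def power_of_mono_pow)

text \<open>One exponent \<open>k\<close> that clears the denominators of \<open>f\<close> gives a
  representative at all points of D_+(X_J) simultaneously.\<close>

lemma fraction_in_germ:
  fixes f :: "'a::{comm_ring,comm_monoid_mult} rpoly"
  assumes J: "finite J" "J \<subseteq> {..n}" and f: "of_degree m f"
    and k: "f * mono_pow J (of_nat k) \<in> laurent n {}" and p: "p \<in> D_mono n J"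
  shows "(f * mono_pow J (of_nat k), mono_pow J (of_nat k)) \<in> germ n m f p"
proof -
  have "(f * mono_pow J (of_nat k), mono_pow J (of_nat k)) \<in> fractions n (twist n m) p"
    unfolding fractions_twist
    using of_degree_mult[OF f of_degree_mono_pow[OF J(1), of "of_nat k"]]
      of_degree_mono_pow[OF J(1), of "of_nat k"] k mono_pow_ratpoly[OF J, of "of_nat k"] mono_pow_notin[OF J p]
    by auto
  moreover from this have "mono_pow J (of_nat k) \<in> homogeneous n - p"
    by (rule fractions_twist_homogeneous)
  ultimately show ?thesis by (auto simp: mem_germ)
qed

lemma germ_nonempty:
  fixes f :: "'a::{comm_ring,comm_monoid_mult} rpoly"
  assumes "finite J" "J \<subseteq> {..n}" "f \<in> laurent n J" "of_degree m f" "p \<in> D_mono n J"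
  shows "germ n m f p \<noteq> {}"
proof -
  obtain k :: nat where "f * mono_pow J (of_nat k) \<in> laurent n {}"
    using laurent_clear_denominators[OF assms(1-3)] by metis
  from fraction_in_germ[OF assms(1,2,4) this assms(5)] show ?thesis by blast
qed

text \<open>\<open>f\<close> need not be homogeneous: \<open>H\<close> is the smallest homogeneous
  ideal containing it, and a homogeneous \<open>p\<close> contains \<open>H\<close> iff it contains
  \<open>f\<close>.\<close>

lemma openin_nonvanishing:
  fixes f :: "'a::{comm_ring,comm_monoid_mult} rpoly"
  assumes "f \<in> laurent n {}"
  shows "openin (Proj_topology n) {p \<in> Proj n. f \<notin> p}"
proof -
  define H where "H = \<Inter>{I. homog_ideal n I \<and> f \<in> I}"
  have "homog_ideal n H"
    unfolding H_def using homog_ideal_carrier[of n] assms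
    by (intro homog_ideal_Inter) (auto simp: carrier_ratpoly_laurent)
  moreover have "H \<subseteq> p \<longleftrightarrow> f \<in> p" if "p \<in> Proj n" for p
    using Proj_homog_ideal[OF that] unfolding H_def by blast
  then have "{p \<in> Proj n. f \<notin> p} = Proj n - Vplus n H" by (auto simp: Vplus_def)
  ultimately show ?thesis unfolding openin_Proj_topology by blast
qed

text \<open>Loci where one homogeneous element does not vanish form a base. \<open>h\<close> is a
  component of an element of the ideal defining \<open>V\<close> and may have degree 0.\<close>

lemma openin_ProjD:
  fixes V :: "'a::{comm_ring,comm_monoid_mult} rpoly set set"
  assumes "openin (Proj_topology n) V" "p \<in> V"
  obtains h d where "p \<in> Proj n" "h \<in> laurent n {}" "of_degree d h" "h \<notin> p"
    "\<And>q. q \<in> Proj n \<Longrightarrow> h \<notin> q \<Longrightarrow> q \<in> V"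
proof -
  obtain I where I: "homog_ideal n I" "V = Proj n - Vplus n I"
    using assms(1) unfolding openin_Proj_topology by blast
  have p: "p \<in> Proj n" "\<not> I \<subseteq> p" using assms(2) by (auto simp: I(2) Vplus_def)
  then obtain x where x: "x \<in> I" "x \<notin> p" by blast
  then obtain d where d: "homog_component d x \<notin> p"
    using homog_ideal_memI[OF Proj_homog_ideal[OF p(1)]] by metis
  have h: "homog_component d x \<in> I" using homog_ideal_component[OF I(1) x(1)] .
  show ?thesis
  proof (rule that[OF p(1) _ of_degree_homog_component d])
    show "homog_component d x \<in> laurent n {}" using homog_ideal_subset[OF I(1)] h by (rule subsetD)
    show "q \<in> V" if "q \<in> Proj n" "homog_component d x \<notin> q" for q
      using that h by (auto simp: I(2) Vplus_def)
  qed
qed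

subsection \<open>Sections over \<open>D\<^sub>+(X\<^sub>J)\<close> are Laurent polynomials\<close>

text \<open>A single fraction represents \<open>f\<close> on all of \<open>D_mono n J\<close>, so
  this whole set serves as the neighbourhood of each point.\<close>

lemma germ_section_carrier:
  fixes f :: "'a::{comm_ring,comm_monoid_mult} rpoly"
  assumes J: "finite J" "J \<subseteq> {..n}" and f: "f \<in> laurent n J" "of_degree m f"
  shows "(\<lambda>p\<in>D_mono n J. germ n m f p) \<in> carrier (O_twist n m (D_mono n J))"
proof -
  obtain k :: nat where k: "f * mono_pow J (of_nat k) \<in> laurent n {}"
    using laurent_clear_denominators[OF J f(1)] by metis
  let ?a = "f * mono_pow J (of_nat k)" and ?s = "mono_pow J (of_nat k) :: 'a rpoly"
  let ?d = "of_nat (card J) * of_nat k :: rat"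
  note mem = fraction_in_germ[OF J f(2) k]
  have eq: "germ n m f p = fraction n (twist n m) p ?a ?s" if "p \<in> D_mono n J" for p
    using germ_eq_fraction[OF _ mem[OF that]] that by (simp add: D_mono_def)
  have stalk: "germ n m f p \<in> stalk n (twist n m) p" if "p \<in> D_mono n J" for p
  proof -
    have "(?a, ?s) \<in> fractions n (twist n m) p" using mem[OF that] by (simp add: mem_germ)
    then show ?thesis unfolding eq[OF that] fraction_def stalk_def by (rule quotientI)
  qed
  have "openin (Proj_topology n) (D_mono n J :: 'a rpoly set set)"
    unfolding D_mono_def using J by (intro openin_nonvanishing mono_pow_ratpoly) auto
  moreover have "?a \<in> twist n m ?d"
    using of_degree_mult[OF f(2) of_degree_mono_pow[OF J(1)]] k by (simp add: twist_def homog_part_laurent)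
  moreover have "?s \<in> homog_part n ?d"
    unfolding homog_part_laurent
    by (intro conjI mono_pow_ratpoly[OF J] of_degree_mono_pow[OF J(1)]) simp
  moreover have "\<forall>q\<in>D_mono n J. ?s \<notin> q \<and> (\<lambda>p\<in>D_mono n J. germ n m f p) q = fraction n (twist n m) q ?a ?s"
  proof
    fix q assume "q \<in> (D_mono n J :: 'a rpoly set set)"
    from mono_pow_notin[OF J this, of k] eq[OF this] this
    show "?s \<notin> q \<and> (\<lambda>p\<in>D_mono n J. germ n m f p) q = fraction n (twist n m) q ?a ?s" by simp
  qed
  ultimately have local: "\<exists>V. openin (Proj_topology n) V \<and> p \<in> V \<and> V \<subseteq> D_mono n J \<and>
      (\<exists>d. \<exists>a\<in>twist n m d. \<exists>s\<in>homog_part n d. \<forall>q\<in>V. s \<notin> q \<and>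
        (\<lambda>p\<in>D_mono n J. germ n m f p) q = fraction n (twist n m) q a s)"
    if "p \<in> D_mono n J" for p
    using that by (intro exI[of _ "D_mono n J"] conjI subset_refl exI[of _ ?d] bexI[of _ ?a] bexI[of _ ?s])
  show ?thesis
    unfolding O_twist_def assoc_sheaf_def using stalk local by simp
qed

text \<open>If all germs agree, \<open>f - g\<close> is killed locally, hence by a power of X_J,
  which is a unit. \<open>J \<noteq> {}\<close> makes the degree of X_J positive.\<close>

lemma germ_section_inj:
  fixes f g :: "'a::{comm_ring,comm_monoid_mult} rpoly"
  assumes J: "finite J" "J \<noteq> {}" "J \<subseteq> {..n}" and f: "f \<in> laurent n J" "of_degree m f"
    and g: "g \<in> laurent n J" "of_degree m g"
    and eq: "\<And>p. p \<in> D_mono n J \<Longrightarrow> germ n m f p = germ n m g p"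
  shows "f = g"
proof -
  have "\<exists>k. power_of (mono_pow J 1) k * (f - g) = 0"
  proof (rule power_annihilates)
    show "of_degree m (f - g)" using f(2) g(2) by (rule of_degree_diff)
    show "mono_pow J 1 \<in> laurent n {}" using J by (intro mono_pow_ratpoly) auto
    show "of_degree (of_nat (card J) * 1) (mono_pow J 1)" using J(1) by (rule of_degree_mono_pow)
    show "0 < (of_nat (card J) * 1 :: rat)" using J by (simp add: card_gt_0_iff)
  next
    fix p assume p: "p \<in> Proj n" "mono_pow J (1::rat) \<notin> (p :: 'a rpoly set)"
    then have D: "p \<in> D_mono n J" by (simp add: D_mono_def)
    obtain a s where as: "(a, s) \<in> germ n m f p"
      using germ_nonempty[OF J(1,3) f D] by auto
    then obtain u where u: "u \<in> homogeneous n - p" "u * (a - f * s) = 0" by (auto simp: mem_germ)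
    have as': "(a, s) \<in> germ n m g p" using as eq[OF D] by simp
    then obtain v where v: "v \<in> homogeneous n - p" "v * (a - g * s) = 0" by (auto simp: mem_germ)
    have s: "s \<in> homogeneous n - p" using as by (auto simp: mem_germ dest: fractions_twist_homogeneous)
    have "(u * v * s) * (f - g) = u * (v * (a - g * s)) - v * (u * (a - f * s))"
      by (simp add: algebra_simps)
    also have "\<dots> = 0" by (simp add: u(2) v(2))
    finally show "\<exists>u\<in>homogeneous n - p. u * (f - g) = 0"
      using homogeneous_notin_mult[OF p(1) homogeneous_notin_mult[OF p(1) u(1) v(1)] s] by blast
  qed
  then obtain k where "mono_pow J (of_nat k) * (f - g) = mono_pow J (of_nat k) * 0"
    by (auto simp: power_of_mono_pow)
  from mono_pow_cancel[OF this] show ?thesis by simp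
qed

text \<open>Fixing a fraction \<open>B q / T q\<close> for \<open>\<sigma>\<close> at every point
  \<open>q\<close> turns statements about \<open>\<sigma>\<close> into polynomial identities at
  \<open>q\<close>; nothing is assumed about how these fractions vary with \<open>q\<close>.\<close>

lemma germ_section_surj:
  fixes \<sigma> :: "'a::{comm_ring,comm_monoid_mult} rpoly set \<Rightarrow> 'a fraction_class"
  assumes J: "finite J" "J \<noteq> {}" "J \<subseteq> {..n}" and \<sigma>: "\<sigma> \<in> carrier (O_twist n m (D_mono n J))"
  obtains f where "f \<in> laurent n J" "of_degree m f" "\<sigma> = (\<lambda>p\<in>D_mono n J. germ n m f p)"
proof -
  define D where "D = (D_mono n J :: 'a rpoly set set)"
  define g where "g = (mono_pow J 1 :: 'a rpoly)"
  define c where "c = (of_nat (card J) :: rat)"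
  have D_iff: "p \<in> D \<longleftrightarrow> p \<in> Proj n \<and> g \<notin> p" for p by (simp add: D_def D_mono_def g_def)
  have g: "g \<in> laurent n {}" "of_degree c g" "0 < c"
    using mono_pow_ratpoly[OF J(1,3), of 1] of_degree_mono_pow[OF J(1), of 1] J
    by (simp_all add: g_def c_def card_gt_0_iff)
  have "\<sigma> \<in> extensional D" and stalk: "\<And>q. q \<in> D \<Longrightarrow> \<sigma> q \<in> stalk n (twist n m) q"
    and local: "\<And>p. p \<in> D \<Longrightarrow> \<exists>V. openin (Proj_topology n) V \<and> p \<in> V \<and> V \<subseteq> D \<and>
      (\<exists>d. \<exists>a\<in>twist n m d. \<exists>s\<in>homog_part n d. \<forall>q\<in>V. s \<notin> q \<and> \<sigma> q = fraction n (twist n m) q a s)"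
    using \<sigma> unfolding O_twist_def assoc_sheaf_def D_def[symmetric]
    by (simp_all add: PiE_iff)
  have "\<exists>z. z \<in> fractions n (twist n m) q \<and> \<sigma> q = fraction n (twist n m) q (fst z) (snd z)" if "q \<in> D" for q
    using stalk[OF that] unfolding stalk_def fraction_def by (auto elim!: quotientE)
  then obtain Z where Z: "\<And>q. q \<in> D \<Longrightarrow> Z q \<in> fractions n (twist n m) q"
      "\<And>q. q \<in> D \<Longrightarrow> \<sigma> q = fraction n (twist n m) q (fst (Z q)) (snd (Z q))"
    by metis
  define B where "B = (\<lambda>q. fst (Z q))"
  define T where "T = (\<lambda>q. snd (Z q))"
  have BT: "(B q, T q) \<in> fractions n (twist n m) q" "\<sigma> q = fraction n (twist n m) q (B q) (T q)"
    if "q \<in> D" for q using Z[OF that] by (simp_all add: B_def T_def)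
  note T = fractions_twist_homogeneous[OF BT(1)]

  \<comment> \<open>\<open>E q f x\<close> says that \<open>f\<close> agrees with \<open>x \<sigma>\<close> at \<open>q\<close>\<close>
  define E where "E = (\<lambda>q f x. \<exists>u\<in>homogeneous n - q. u * (f * T q - x * B q) = 0)"
  have E_add: "E q (f + f') (x + x')" if q: "q \<in> D" and EE: "E q f x" "E q f' x'" for q f f' x x'
  proof -
    obtain u v where u: "u \<in> homogeneous n - q" "u * (f * T q - x * B q) = 0"
      and v: "v \<in> homogeneous n - q" "v * (f' * T q - x' * B q) = 0" using EE by (auto simp: E_def)
    have "(u * v) * ((f + f') * T q - (x + x') * B q)
        = v * (u * (f * T q - x * B q)) + u * (v * (f' * T q - x' * B q))"
      by (simp add: algebra_simps)
    then have "(u * v) * ((f + f') * T q - (x + x') * B q) = 0" by (simp add: u(2) v(2))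
    then show ?thesis
      using homogeneous_notin_mult[OF _ u(1) v(1)] q unfolding E_def D_iff by blast
  qed
  have E_mult: "E q (z * f) (z * x)" if EE: "E q f x" for q f x z
  proof -
    obtain u where u: "u \<in> homogeneous n - q" "u * (f * T q - x * B q) = 0"
      using EE by (auto simp: E_def)
    have "u * (z * f * T q - z * x * B q) = z * (u * (f * T q - x * B q))" by (simp add: algebra_simps)
    then have "u * (z * f * T q - z * x * B q) = 0" by (simp add: u(2))
    then show ?thesis using u(1) unfolding E_def by blast
  qed
  \<comment> \<open>Here \<open>a = s \<sigma>\<close> and \<open>b = t \<sigma>\<close> at
    \<open>q\<close>, so the cross difference vanishes there.\<close>
  have E_trans: "\<exists>u\<in>homogeneous n - q. u * (a * t - b * s) = 0"
    if q: "q \<in> D" and EE: "E q a s" "E q b t" for q a s b t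
  proof -
    obtain u v where u: "u \<in> homogeneous n - q" "u * (a * T q - s * B q) = 0"
      and v: "v \<in> homogeneous n - q" "v * (b * T q - t * B q) = 0" using EE by (auto simp: E_def)
    have "(u * v * T q) * (a * t - b * s)
        = v * t * (u * (a * T q - s * B q)) - u * s * (v * (b * T q - t * B q))"
      by (simp add: algebra_simps)
    also have "\<dots> = 0" by (simp add: u(2) v(2))
    finally show ?thesis
      using homogeneous_notin_mult[OF _ homogeneous_notin_mult[OF _ u(1) v(1)] T[OF q]] q
      unfolding D_iff by blast
  qed
  \<comment> \<open>Conversely, if \<open>b = t \<sigma>\<close> with \<open>t\<close> invertible at
    \<open>q\<close>, then \<open>f * t = x * b\<close> at \<open>q\<close> yields
    \<open>f = x \<sigma>\<close>.\<close>
  have E_conv: "E q f x"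
    if q: "q \<in> D" and bt: "E q b t" "t \<in> homogeneous n - q"
      and u: "u \<in> homogeneous n - q" "u * (f * t - x * b) = 0" for q f x b t u
  proof -
    obtain w where w: "w \<in> homogeneous n - q" "w * (b * T q - t * B q) = 0"
      using bt(1) by (auto simp: E_def)
    have "(u * w * t) * (f * T q - x * B q)
        = w * T q * (u * (f * t - x * b)) + u * x * (w * (b * T q - t * B q))"
      by (simp add: algebra_simps)
    then have "(u * w * t) * (f * T q - x * B q) = 0" by (simp add: u(2) w(2))
    then show ?thesis
      using homogeneous_notin_mult[OF _ homogeneous_notin_mult[OF _ u(1) w(1)] bt(2)] q
      unfolding D_iff E_def by blast
  qed

  \<comment> \<open>Expanding \<open>a/s\<close> by an \<open>h\<close> that cuts out a
    neighbourhood inside \<open>V\<close> gives a fraction valid wherever its own denominator is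
    invertible.\<close>
  have local': "\<exists>d b t. b \<in> laurent n {} \<and> of_degree (m + d) b \<and> t \<in> laurent n {} \<and> of_degree d t \<and>
      t \<notin> p \<and> (\<forall>q\<in>Proj n. t \<notin> q \<longrightarrow> q \<in> D \<and> E q b t)" if pD: "p \<in> D" for p
  proof -
    from local[OF pD] obtain V where V': "openin (Proj_topology n) V \<and> p \<in> V \<and> V \<subseteq> D \<and>
      (\<exists>d. \<exists>a\<in>twist n m d. \<exists>s\<in>homog_part n d. \<forall>q\<in>V. s \<notin> q \<and> \<sigma> q = fraction n (twist n m) q a s)"
      by (rule exE)
    then have V: "openin (Proj_topology n) V" "p \<in> V" "V \<subseteq> D" by simp_all
    from V' obtain d a s where as: "a \<in> twist n m d" "s \<in> homog_part n d"
      and "\<forall>q\<in>V. s \<notin> q \<and> \<sigma> q = fraction n (twist n m) q a s"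
      by (elim exE bexE conjE)
    then have s: "s \<notin> q \<and> \<sigma> q = fraction n (twist n m) q a s" if "q \<in> V" for q
      using that by simp
    obtain h e where p: "p \<in> Proj n" and h: "h \<in> laurent n {}" "of_degree e h" "h \<notin> p"
      and hV: "\<And>q. q \<in> Proj n \<Longrightarrow> h \<notin> q \<Longrightarrow> q \<in> V"
      by (rule openin_ProjD[OF V(1,2)]) (rule that; assumption)
    have as': "a \<in> laurent n {}" "of_degree (m + d) a" "s \<in> laurent n {}" "of_degree d s"
      using as by (simp_all add: twist_def homog_part_laurent)
    have "of_degree (m + (e + d)) (h * a)"
      using of_degree_mult[OF h(2) as'(2)] by (simp add: ac_simps)
    moreover have "of_degree (e + d) (h * s)" using h(2) as'(4) by (rule of_degree_mult)
    moreover have "h * s \<notin> p" using h s[OF V(2)] Proj_notin_mult[OF p h(1) as'(3)] by simp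
    moreover have "q \<in> D \<and> E q (h * a) (h * s)" if q: "q \<in> Proj n" "h * s \<notin> q" for q
    proof
      have "h \<notin> q" using q Proj_notin_mult[OF q(1) h(1) as'(3)] by simp
      then have qV: "q \<in> V" by (rule hV[OF q(1)])
      then show qD: "q \<in> D" using V(3) by blast
      have "(a, s) \<in> fractions n (twist n m) q"
        unfolding fractions_twist using as' s[OF qV] by blast
      moreover from this have "(a, s) \<in> fraction n (twist n m) q a s"
        unfolding mem_fraction by (intro conjI bexI[OF _ fractions_twist_homogeneous]) simp_all
      then have "(a, s) \<in> fraction n (twist n m) q (B q) (T q)" using s[OF qV] BT(2)[OF qD] by simp
      then obtain u where u: "u \<in> homogeneous n - q" "u * (B q * s - a * T q) = 0"
        unfolding mem_fraction by blast
      have "u * (a * T q - s * B q) = - (u * (B q * s - a * T q))" by (simp add: algebra_simps)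
      then have "u * (a * T q - s * B q) = 0" by (simp add: u(2))
      then have "E q a s" using u(1) unfolding E_def by blast
      then show "E q (h * a) (h * s)" by (rule E_mult)
    qed
    ultimately show ?thesis
      using laurent_mult[OF h(1) as'(1)] laurent_mult[OF h(1) as'(3)]
      by (intro exI[of _ "e + d"] exI[of _ "h * a"] exI[of _ "h * s"] conjI ballI impI) simp_all
  qed

  \<comment> \<open>\<open>t \<sigma> - b\<close> vanishes where \<open>t\<close> is invertible, so it is killed by a power of \<open>t\<close>\<close>
  have power: "\<exists>N. \<forall>q\<in>D. E q (power_of t N * b) (power_of t N * t)"
    if b: "b \<in> laurent n {}" "of_degree (m + d) b" and t: "t \<in> laurent n {}" "of_degree d t"
      and bt: "\<And>q. q \<in> Proj n \<Longrightarrow> t \<notin> q \<Longrightarrow> q \<in> D \<and> E q b t" and nz: "t \<noteq> 0" for b t d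
  proof -
    define Q where "Q = (\<lambda>N q. E q (power_of t N * b) (power_of t N * t))"
    define K where "K = {x \<in> laurent n {}. \<exists>N. \<forall>q\<in>D. x \<notin> q \<longrightarrow> Q N q}"
    have Q_mono: "Q (k + N) q" if "Q N q" for k N q
      using E_mult[OF that[unfolded Q_def], of "power_of t k"] by (simp add: Q_def power_of_add mult.assoc)
    have KI: "x \<in> K" if "x \<in> laurent n {}" "\<And>q. q \<in> D \<Longrightarrow> x \<notin> q \<Longrightarrow> Q N q" for x N
      using that unfolding K_def by blast
    have KE: "\<exists>N. \<forall>q. q \<in> D \<longrightarrow> x \<notin> q \<longrightarrow> Q N q" if "x \<in> K" for x
      using that unfolding K_def by blast
    have D_ideal: "homog_ideal n q" if "q \<in> D" for q using that by (simp add: D_iff Proj_homog_ideal)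
    have K: "homog_ideal n K"
    proof (rule homog_idealI)
      show sub: "K \<subseteq> laurent n {}" by (simp add: K_def)
      show "0 \<in> K" using homog_ideal_zero[OF D_ideal] by (intro KI) auto
      fix x assume x: "x \<in> K"
      note xl = subsetD[OF sub x]
      obtain N where N: "\<And>q. q \<in> D \<Longrightarrow> x \<notin> q \<Longrightarrow> Q N q" using KE[OF x] by metis
      show "x + y \<in> K" if y: "y \<in> K" for y
      proof -
        obtain N' where N': "\<And>q. q \<in> D \<Longrightarrow> y \<notin> q \<Longrightarrow> Q N' q" using KE[OF y] by metis
        show ?thesis
        proof (rule KI)
          show "x + y \<in> laurent n {}" using xl subsetD[OF sub y] by (rule laurent_add)
          fix q assume q: "q \<in> D" "x + y \<notin> q"
          \<comment> \<open>At each point one of the two exponents works, and \<open>Q_mono\<close>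
            raises either one to \<open>N + N'\<close>.\<close>
          then have "x \<notin> q \<or> y \<notin> q" using homog_ideal_add[OF D_ideal[OF q(1)]] by metis
          then show "Q (N + N') q"
            using Q_mono[of N q N'] Q_mono[of N' q N] N[OF q(1)] N'[OF q(1)] by (auto simp: add.commute)
        qed
      qed
      show "y * x \<in> K" if y: "y \<in> laurent n {}" for y
      proof (rule KI)
        show "y * x \<in> laurent n {}" using y xl by (rule laurent_mult)
        show "Q N q" if q: "q \<in> D" "y * x \<notin> q" for q
          using N[OF q(1)] homog_ideal_mult[OF D_ideal[OF q(1)] _ y] q(2) by metis
      qed
      show "homog_component e x \<in> K" for e
      proof (rule KI)
        show "homog_component e x \<in> laurent n {}" using xl by (rule laurent_homog_component)
        show "Q N q" if q: "q \<in> D" "homog_component e x \<notin> q" for q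
          using N[OF q(1)] homog_ideal_component[OF D_ideal[OF q(1)]] q(2) by metis
      qed
    qed
    have "\<exists>k. power_of g k \<in> K"
    proof (rule power_in_homog_ideal[OF K g])
      fix p assume p: "p \<in> Proj n" "g \<notin> p"
      then have "p \<in> D" by (simp add: D_iff)
      obtain d' b' t' where b': "b' \<in> laurent n {}" "of_degree (m + d') b'"
        and t': "t' \<in> laurent n {}" "of_degree d' t'" "t' \<notin> p"
        and bt': "\<And>q. q \<in> Proj n \<Longrightarrow> t' \<notin> q \<Longrightarrow> q \<in> D \<and> E q b' t'"
        using local'[OF \<open>p \<in> D\<close>] by (elim exE conjE) simp
      have "t' \<noteq> 0" using t'(3) homog_ideal_zero[OF Proj_homog_ideal[OF p(1)]] by metis
      then have pos: "0 < c + (d' + d)"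
        using of_degree_nonneg[OF t'(1,2)] of_degree_nonneg[OF t nz] g(3) by linarith
      have t't: "t' * t \<in> laurent n {}" using t'(1) t(1) by (rule laurent_mult)
      \<comment> \<open>The factor \<open>g\<close> makes the degree positive even when
        \<open>t\<close> and \<open>t'\<close> have degree 0.\<close>
      let ?h = "g * (t' * t)"
      have h: "?h \<in> laurent n {}" using g(1) t't by (rule laurent_mult)
      have hd: "of_degree (c + (d' + d)) ?h" using g(2) t(2) t'(2) by (intro of_degree_mult)
      \<comment> \<open>Where \<open>t\<close> and \<open>t'\<close> are both invertible,
        \<open>b/t\<close> and \<open>b'/t'\<close> are the same section, so their cross difference
        is killed locally.\<close>
      have "\<exists>k. power_of ?h k * (b * t' - b' * t) = 0"
      proof (rule power_annihilates[OF _ h hd pos])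
        show "of_degree (m + d + d') (b * t' - b' * t)"
        proof (rule of_degree_diff)
          show "of_degree (m + d + d') (b * t')" using b(2) t'(2) by (rule of_degree_mult)
          show "of_degree (m + d + d') (b' * t)" using of_degree_mult[OF b'(2) t(2)] by (simp add: ac_simps)
        qed
        fix q assume q: "q \<in> Proj n" "?h \<notin> q"
        then have "t \<notin> q" "t' \<notin> q"
          using Proj_notin_mult[OF q(1) g(1) t't] Proj_notin_mult[OF q(1) t'(1) t(1)] by simp_all
        then show "\<exists>u\<in>homogeneous n - q. u * (b * t' - b' * t) = 0"
          using bt[OF q(1)] bt'[OF q(1)] by (intro E_trans) simp_all
      qed
      then obtain k where k: "power_of ?h k * (b * t' - b' * t) = 0" by blast
      have "t' \<in> K"
      proof (rule KI[OF t'(1)])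
        fix q assume q: "q \<in> D" "t' \<notin> q"
        then have qP: "q \<in> Proj n" "g \<notin> q" by (simp_all add: D_iff)
        have hom: "power_of x k \<in> homogeneous n - q" if "x \<in> laurent n {}" "of_degree e x" "x \<notin> q" for x e
          using power_of_laurent[OF that(1)] of_degree_power_of[OF that(2)] Proj_notin_power_of[OF qP(1) that(1,3)]
          by (auto simp: homogeneous_iff)
        have u: "power_of g k * power_of t' k \<in> homogeneous n - q"
          by (intro homogeneous_notin_mult[OF qP(1)] hom[OF g(1,2) qP(2)] hom[OF t'(1,2) q(2)])
        have "(power_of g k * power_of t' k) * (power_of t k * b * t' - power_of t k * t * b')
            = power_of ?h k * (b * t' - b' * t)"
          by (simp add: power_of_mult algebra_simps)
        also note k
        finally have zero: "(power_of g k * power_of t' k) * (power_of t k * b * t' - power_of t k * t * b') = 0" .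
        have "t' \<in> homogeneous n - q" using t'(1,2) q(2) by (auto simp: homogeneous_iff)
        moreover have "E q b' t'" using bt'[OF qP(1) q(2)] by simp
        ultimately show "Q k q"
          unfolding Q_def by (intro E_conv[OF q(1) _ _ u zero])
      qed
      then show "\<not> K \<subseteq> p" using t'(3) by blast
    qed
    then obtain k where "power_of g k \<in> K" by blast
    then obtain N where N: "\<And>q. q \<in> D \<Longrightarrow> power_of g k \<notin> q \<Longrightarrow> Q N q" using KE by metis
    have "Q N q" if "q \<in> D" for q
      using N[OF that] Proj_notin_power_of[OF _ g(1)] that by (simp add: D_iff)
    then show ?thesis unfolding Q_def by blast
  qed

  \<comment> \<open>\<open>I\<close> is the ideal of denominators of \<open>\<sigma>\<close>\<close>
  define I where "I = {x \<in> laurent n {}. \<exists>f\<in>laurent n J. \<forall>q\<in>D. E q f x}"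
  have II: "x \<in> I" if "x \<in> laurent n {}" "f \<in> laurent n J" "\<And>q. q \<in> D \<Longrightarrow> E q f x" for x f
    using that unfolding I_def by blast
  have IE: "\<exists>f. f \<in> laurent n J \<and> (\<forall>q. q \<in> D \<longrightarrow> E q f x)" if "x \<in> I" for x
    using that unfolding I_def by blast
  \<comment> \<open>\<open>\<sigma>\<close> has degree \<open>m\<close>, so the part of
    \<open>x\<close> of degree \<open>e\<close> corresponds to the part of \<open>f\<close> of
    degree \<open>e + m\<close>.\<close>
  have E_component: "E q (homog_component (e + m) f) (homog_component e x)" if q: "q \<in> D" and EE: "E q f x" for q f x e
  proof -
    obtain u where u: "u \<in> homogeneous n - q" "u * (f * T q - x * B q) = 0"
      using EE by (auto simp: E_def)
    obtain du where du: "of_degree du u" using u(1) by (auto simp: homogeneous_iff)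
    obtain d where d: "of_degree (m + d) (B q)" "of_degree d (T q)"
      using BT(1)[OF q] by (auto simp: fractions_twist)
    have "u * (f * T q) = f * (T q * u)" "u * (x * B q) = x * (B q * u)" by (simp_all add: ac_simps)
    then have eq: "f * (T q * u) = x * (B q * u)" using u(2) by (simp add: right_diff_distrib)
    have "homog_component ((e + m) + (d + du)) (f * (T q * u)) = homog_component (e + m) f * (T q * u)"
      using d(2) du by (intro homog_component_mult of_degree_mult)
    moreover have "homog_component (e + (m + d + du)) (x * (B q * u)) = homog_component e x * (B q * u)"
      using d(1) du by (intro homog_component_mult of_degree_mult)
    ultimately have "homog_component (e + m) f * (T q * u) = homog_component e x * (B q * u)"
      using eq by (simp add: ac_simps)
    then have "u * (homog_component (e + m) f * T q - homog_component e x * B q) = 0"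
      by (simp add: right_diff_distrib ac_simps)
    then show ?thesis using u(1) unfolding E_def by blast
  qed
  have I: "homog_ideal n I"
  proof (rule homog_idealI)
    show sub: "I \<subseteq> laurent n {}" by (simp add: I_def)
    have "E q 0 0" if "q \<in> D" for q using T[OF that] by (auto simp: E_def)
    then show "0 \<in> I" by (rule II[OF laurent_0 laurent_0])
    fix x assume x: "x \<in> I"
    note xl = subsetD[OF sub x]
    obtain f where f: "f \<in> laurent n J" "\<And>q. q \<in> D \<Longrightarrow> E q f x" using IE[OF x] by metis
    show "x + y \<in> I" if y: "y \<in> I" for y
    proof -
      obtain f' where f': "f' \<in> laurent n J" "\<And>q. q \<in> D \<Longrightarrow> E q f' y" using IE[OF y] by metis
      show ?thesis
        by (rule II[OF laurent_add[OF xl subsetD[OF sub y]] laurent_add[OF f(1) f'(1)] E_add[OF _ f(2) f'(2)]])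
    qed
    show "y * x \<in> I" if y: "y \<in> laurent n {}" for y
    proof (rule II[OF laurent_mult[OF y xl] laurent_mult[OF _ f(1)] E_mult[OF f(2)]])
      show "y \<in> laurent n J" using laurent_mono[of "{}" J n] y by blast
    qed
    show "homog_component e x \<in> I" for e
      by (rule II[OF laurent_homog_component[OF xl] laurent_homog_component[OF f(1)] E_component[OF _ f(2)]])
  qed
  have "\<exists>k. power_of g k \<in> I"
  proof (rule power_in_homog_ideal[OF I g])
    fix p assume p: "p \<in> Proj n" "g \<notin> p"
    then have "p \<in> D" by (simp add: D_iff)
    obtain d b t where b: "b \<in> laurent n {}" "of_degree (m + d) b"
      and t: "t \<in> laurent n {}" "of_degree d t" "t \<notin> p"
      and bt: "\<And>q. q \<in> Proj n \<Longrightarrow> t \<notin> q \<Longrightarrow> q \<in> D \<and> E q b t"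
      using local'[OF \<open>p \<in> D\<close>] by (elim exE conjE) simp
    have "t \<noteq> 0" using t(3) homog_ideal_zero[OF Proj_homog_ideal[OF p(1)]] by metis
    then obtain N where N: "\<And>q. q \<in> D \<Longrightarrow> E q (power_of t N * b) (power_of t N * t)"
      using power[OF b t(1,2) bt] by metis
    \<comment> \<open>The polynomial \<open>power_of t N * b\<close> is the numerator belonging to
      this denominator.\<close>
    have "power_of t N * t \<in> I"
    proof (rule II[OF _ _ N])
      show "power_of t N * t \<in> laurent n {}" by (intro laurent_mult power_of_laurent t(1))
      have "power_of t N * b \<in> laurent n {}" by (intro laurent_mult power_of_laurent t(1) b(1))
      then show "power_of t N * b \<in> laurent n J" using laurent_mono[of "{}" J n] by blast
    qed
    moreover have "power_of t (Suc N) \<notin> p" using p(1) t(1,3) by (rule Proj_notin_power_of)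
    ultimately show "\<not> I \<subseteq> p" by (auto simp: mult.commute)
  qed
  then obtain k f where f: "f \<in> laurent n J" "\<And>q. q \<in> D \<Longrightarrow> E q f (power_of g k)"
    using IE by metis
  define e where "e = of_nat k * c"
  have gk: "power_of g k = mono_pow J (of_nat k)" by (simp add: g_def power_of_mono_pow)
  have comp: "homog_component e (power_of g k) = power_of g k"
    using homog_component_of_degree[OF of_degree_power_of[OF g(2)], of e k] by (simp add: e_def)
  \<comment> \<open>\<open>f\<close> may be inhomogeneous, but \<open>power_of g k\<close> has
    degree \<open>e\<close>, so only the part of \<open>f\<close> in degree \<open>e + m\<close>
    matters; dividing it by X_J^k leaves degree \<open>m\<close>.\<close>
  define f' where "f' = mono_pow J (- of_nat k) * homog_component (e + m) f"
  have f'_eq: "power_of g k * f' = homog_component (e + m) f"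
    by (simp add: gk f'_def mono_pow_inverse)
  show ?thesis
  proof (rule that)
    show "f' \<in> laurent n J"
      unfolding f'_def using J f(1) by (intro laurent_mult mono_pow_laurent laurent_homog_component)
    show f'd: "of_degree m f'"
      using of_degree_mult[OF of_degree_mono_pow[OF J(1), of "- of_nat k"] of_degree_homog_component, of "e + m" f]
      by (simp add: f'_def e_def c_def mult.commute)
    have "\<sigma> q = germ n m f' q" if q: "q \<in> D" for q
    proof -
      have qP: "q \<in> Proj n" using q by (simp add: D_iff)
      obtain u where u: "u \<in> homogeneous n - q" "u * (power_of g k * f' * T q - power_of g k * B q) = 0"
        using E_component[OF q f(2)[OF q], of e] unfolding comp f'_eq[symmetric] E_def by blast
      have "mono_pow J (of_nat k) * (u * (B q - f' * T q)) = - (u * (power_of g k * f' * T q - power_of g k * B q))"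
        unfolding gk by (simp add: algebra_simps)
      then have "u * (B q - f' * T q) = 0"
        using u(2) mono_pow_cancel[of J "of_nat k" "u * (B q - f' * T q)" 0] by simp
      then have "(B q, T q) \<in> germ n m f' q" using BT(1)[OF q] u(1) by (auto simp: mem_germ)
      from germ_eq_fraction[OF qP this] show ?thesis using BT(2)[OF q] by simp
    qed
    then show "\<sigma> = (\<lambda>p\<in>D_mono n J. germ n m f' p)"
      using \<open>\<sigma> \<in> extensional D\<close> unfolding D_def[symmetric]
      by (intro extensionalityI[of _ D]) auto
  qed
qed

subsection \<open>The Cech complex of Laurent polynomials\<close>

text \<open>Also used for \<open>j\<close> outside \<open>J\<close>, where the number counted is the
  position that \<open>j\<close> would take after insertion.\<close>

definition signed :: "nat \<Rightarrow> nat set \<Rightarrow> 'b::ab_group_add \<Rightarrow> 'b" where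
  "signed j J x = (if even (card {i\<in>J. i < j}) then x else - x)"

text \<open>The Cech differential with inclusions of Laurent rings in place of restriction maps. The
  general value group allows it to be applied to polynomials and to single coefficients.\<close>

definition delta :: "(nat set \<Rightarrow> 'b::ab_group_add) \<Rightarrow> nat set \<Rightarrow> 'b" where
  "delta f J = (\<Sum>j\<in>J. signed j J (f (J - {j})))"

lemma signed_0 [simp]: "signed j J 0 = 0"
  by (simp add: signed_def)

lemma signed_minus: "signed j J (- x) = - signed j J x"
  by (simp add: signed_def)

lemma signed_signed [simp]: "signed j J (signed j J x) = x"
  by (simp add: signed_def)

lemma signed_add: "signed j J (x + y) = signed j J x + signed j J y"
  by (simp add: signed_def)

lemma signed_sum: "signed j J (sum f A) = (\<Sum>i\<in>A. signed j J (f i))"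
  by (simp add: signed_def sum_negf)

lemma signed_Diff_self [simp]: "signed j (J - {j}) = signed j J"
proof -
  have "{i \<in> J - {j}. i < j} = {i \<in> J. i < j}" by auto
  then show ?thesis by (simp add: signed_def fun_eq_iff)
qed

lemma card_less_remove:
  assumes "finite J" "k \<in> J"
  shows "card {i\<in>J. i < j} = card {i\<in>J - {k}. i < j} + (if k < j then 1 else 0)"
proof (cases "k < j")
  case True
  then have "{i\<in>J. i < j} = insert k {i\<in>J - {k}. i < j}" using assms(2) by auto
  then show ?thesis using True assms(1) by simp
next
  case False
  then have "{i\<in>J. i < j} = {i\<in>J - {k}. i < j}" by auto
  then show ?thesis using False by simp
qed

text \<open>Removing the smaller of \<open>j\<close> and \<open>k\<close> lowers the position of the
  larger by one, while removing the larger does not move the smaller; hence exactly one sign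
  flips.\<close>

lemma signed_swap:
  assumes "finite J" "j \<in> J" "k \<in> J" "j \<noteq> k"
  shows "signed j J (signed k (J - {j}) x) = - signed k J (signed j (J - {k}) x)"
  using assms card_less_remove[OF assms(1,2), of k] card_less_remove[OF assms(1,3), of j]
  by (cases "j < k") (simp_all add: signed_def)

lemma signed_swap_remove:
  assumes "finite J" "j \<in> J" "v \<in> J" "j \<noteq> v"
  shows "signed v J (signed j J x) = - signed j (J - {v}) (signed v (J - {j}) x)"
  using assms card_less_remove[OF assms(1,2), of v] card_less_remove[OF assms(1,3), of j]
  by (cases "j < v") (simp_all add: signed_def)

text \<open>Removing \<open>j\<close> then \<open>k\<close> cancels against removing
  \<open>k\<close> then \<open>j\<close>. The two orders are paired explicitly through
  \<open>prod.swap\<close>, so 2-torsion does no harm.\<close>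

lemma delta_delta:
  fixes f :: "nat set \<Rightarrow> 'b::ab_group_add"
  assumes "finite J"
  shows "delta (delta f) J = 0"
proof -
  define t where "t = (\<lambda>(j, k). signed j J (signed k (J - {j}) (f (J - {j} - {k}))))"
  let ?A = "{(j, k). j \<in> J \<and> k \<in> J \<and> j < k}" and ?B = "{(j, k). j \<in> J \<and> k \<in> J \<and> k < j}"
  have fin: "finite ?A" "finite ?B"
    by (rule finite_subset[OF _ finite_cartesian_product[OF assms assms]], blast)+
  have "delta (delta f) J = (\<Sum>j\<in>J. \<Sum>k\<in>J - {j}. t (j, k))"
    by (simp add: delta_def signed_sum t_def)
  also have "\<dots> = sum t (SIGMA j:J. J - {j})"
    using assms by (simp add: sum.Sigma)
  also have "(SIGMA j:J. J - {j}) = ?A \<union> ?B" by auto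
  also have "sum t \<dots> = sum t ?A + sum t ?B"
    by (rule sum.union_disjoint[OF fin]) force
  also have "?B = prod.swap ` ?A" by force
  also have "sum t (prod.swap ` ?A) = sum (t \<circ> prod.swap) ?A"
    by (rule sum.reindex) (simp add: inj_on_def)
  also have "\<dots> = (\<Sum>z\<in>?A. - t z)"
  proof (rule sum.cong[OF refl])
    fix z assume "z \<in> ?A"
    then obtain j k where z: "z = (j, k)" "j \<in> J" "k \<in> J" "j \<noteq> k" by (cases z) simp
    have "J - {k} - {j} = J - {j} - {k}" by blast
    then show "(t \<circ> prod.swap) z = - t z"
      using signed_swap[OF assms z(2-4), of "f (J - {j} - {k})"] by (simp add: z(1) t_def)
  qed
  finally show ?thesis by (simp add: sum_negf)
qed

text \<open>If \<open>v \<in> J\<close>, only the term removing \<open>v\<close> survives and its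
  two signs cancel. Otherwise, in the cocycle condition at \<open>insert v J\<close>, the term
  removing \<open>v\<close> is \<open>f J\<close> up to sign and the others are the terms of the
  homotopy.\<close>

lemma contracting_homotopy:
  fixes f :: "nat set \<Rightarrow> 'b::ab_group_add"
  assumes fin: "finite J" and cocycle: "v \<notin> J \<Longrightarrow> delta f (insert v J) = 0"
  shows "delta (\<lambda>K. if v \<in> K then 0 else signed v K (f (insert v K))) J = f J"
proof (cases "v \<in> J")
  case True
  have "delta (\<lambda>K. if v \<in> K then 0 else signed v K (f (insert v K))) J = (\<Sum>j\<in>J. if j = v then f J else 0)"
    unfolding delta_def using True by (intro sum.cong) (auto simp: insert_absorb)
  then show ?thesis using True fin by simp
next
  case False
  let ?J = "insert v J"
  have "delta f ?J = signed v ?J (f J) + (\<Sum>j\<in>J. signed j ?J (f (?J - {j})))"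
    using False fin by (simp add: delta_def)
  \<comment> \<open>Multiplication by the sign of \<open>v\<close> gives \<open>f J\<close> the
    coefficient 1.\<close>
  then have "0 = signed v ?J (signed v ?J (f J) + (\<Sum>j\<in>J. signed j ?J (f (?J - {j}))))"
    using cocycle[OF False] by simp
  also have "\<dots> = f J + (\<Sum>j\<in>J. signed v ?J (signed j ?J (f (?J - {j}))))"
    by (simp add: signed_add signed_sum)
  also have "(\<Sum>j\<in>J. signed v ?J (signed j ?J (f (?J - {j})))) =
      (\<Sum>j\<in>J. - signed j J (signed v (J - {j}) (f (insert v (J - {j})))))"
  proof (rule sum.cong[OF refl])
    fix j assume j: "j \<in> J"
    then have ne: "j \<noteq> v" using False by auto
    then have eq: "?J - {j} = insert v (J - {j})" by auto
    have "insert v (J - {j}) - {v} = J - {j}" using False by auto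
    then have "signed v (insert v (J - {j})) x = signed v (J - {j}) x" for x :: 'b
      using signed_Diff_self[of v "insert v (J - {j})"] by metis
    then show "signed v ?J (signed j ?J (f (?J - {j}))) = - signed j J (signed v (J - {j}) (f (insert v (J - {j}))))"
      using signed_swap_remove[of ?J j v "f (insert v (J - {j}))"] fin j ne False by (simp add: eq)
  qed
  finally have "f J = (\<Sum>j\<in>J. signed j J (signed v (J - {j}) (f (insert v (J - {j})))))"
    by (simp add: sum_negf)
  then show ?thesis using False unfolding delta_def by simp
qed

definition laurent_part :: "nat \<Rightarrow> rat \<Rightarrow> nat set \<Rightarrow> 'a::{comm_ring,comm_monoid_mult} rpoly set" where
  "laurent_part n m J = {f \<in> laurent n J. of_degree m f}"

text \<open>The homotopy splits off, for each exponent vector \<open>e\<close>, the smallest coordinate in which \<open>e\<close>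
  is nonnegative; it exists among \<open>0, \<dots>, n\<close> unless \<open>e\<close> only occurs for \<open>J = {..n}\<close>.\<close>

definition pivot :: "(nat \<Rightarrow>\<^sub>0 rat) \<Rightarrow> nat" where
  "pivot e = (LEAST i. 0 \<le> Poly_Mapping.lookup e i)"

text \<open>Finite support provides a coordinate equal to 0, so the least index exists. It exceeds
  \<open>n\<close> exactly when all coordinates up to \<open>n\<close> are negative.\<close>

lemma pivot_nonneg: "0 \<le> Poly_Mapping.lookup e (pivot e)"
proof -
  obtain i where "i \<notin> Poly_Mapping.keys e" using ex_new_if_finite[of "Poly_Mapping.keys e"] by auto
  then have "0 \<le> Poly_Mapping.lookup e i" by (simp add: in_keys_iff)
  then show ?thesis unfolding pivot_def by (rule LeastI)
qed

lemma pivot_le: "0 \<le> Poly_Mapping.lookup e i \<Longrightarrow> pivot e \<le> i"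
  unfolding pivot_def by (rule Least_le)

text \<open>Summand \<open>v\<close> applies the homotopy "insert \<open>v\<close>" to the monomials
  with pivot \<open>v\<close>; summing over \<open>v\<close> reassembles the homotopies of the
  separate exponent vectors into one polynomial.\<close>

definition homotopy :: "nat \<Rightarrow> (nat set \<Rightarrow> 'a::{comm_ring,comm_monoid_mult} rpoly) \<Rightarrow> nat set \<Rightarrow> 'a rpoly" where
  "homotopy n f J = (\<Sum>v\<in>{..n} - J. signed v J
     (\<Sum>e\<in>{e \<in> Poly_Mapping.keys (f (insert v J)). pivot e = v}.
        Poly_Mapping.single e (Poly_Mapping.lookup (f (insert v J)) e)))"

lemma lookup_signed: "Poly_Mapping.lookup (signed j J f) e = signed j J (Poly_Mapping.lookup f e)"
  by (simp add: signed_def)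

lemma lookup_delta: "Poly_Mapping.lookup (delta f J) e = delta (\<lambda>K. Poly_Mapping.lookup (f K) e) J"
  by (simp add: delta_def lookup_sum lookup_signed)

lemma lookup_homotopy:
  fixes f :: "nat set \<Rightarrow> 'a::{comm_ring,comm_monoid_mult} rpoly"
  shows "Poly_Mapping.lookup (homotopy n f J) e =
     (if pivot e \<le> n \<and> pivot e \<notin> J then signed (pivot e) J (Poly_Mapping.lookup (f (insert (pivot e) J)) e) else 0)"
proof -
  have part: "Poly_Mapping.lookup (\<Sum>e\<in>{e \<in> Poly_Mapping.keys g. pivot e = v}.
        Poly_Mapping.single e (Poly_Mapping.lookup g e)) e
      = (if v = pivot e then Poly_Mapping.lookup g e else 0)" for g :: "'a rpoly" and v
  proof -
    have "Poly_Mapping.lookup (\<Sum>e\<in>{e \<in> Poly_Mapping.keys g. pivot e = v}.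
        Poly_Mapping.single e (Poly_Mapping.lookup g e)) e
      = (\<Sum>k\<in>{k\<in>Poly_Mapping.keys g. pivot k = v}. if k = e then Poly_Mapping.lookup g k else 0)"
      unfolding lookup_sum by (rule sum.cong) (auto simp: lookup_single when_def)
    also have "\<dots> = (if v = pivot e then Poly_Mapping.lookup g e else 0)"
      by (subst sum.delta) (auto simp: in_keys_iff)
    finally show ?thesis .
  qed
  have "Poly_Mapping.lookup (homotopy n f J) e
      = (\<Sum>v\<in>{..n} - J. if v = pivot e then signed v J (Poly_Mapping.lookup (f (insert v J)) e) else 0)"
    unfolding homotopy_def
    by (subst lookup_sum, rule sum.cong[OF refl]) (simp add: lookup_signed part)
  then show ?thesis by (simp add: sum.delta)
qed

text \<open>A monomial allowed for \<open>insert v J\<close> is already allowed for \<open>J\<close>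
  when \<open>v\<close> is its pivot, because its exponent at \<open>v\<close> is
  nonnegative.\<close>

lemma homotopy_laurent_part:
  assumes f: "\<And>v. v \<in> {..n} - J \<Longrightarrow> f (insert v J) \<in> laurent_part n m (insert v J)"
  shows "homotopy n f J \<in> laurent_part n m J"
proof -
  have "Poly_Mapping.keys e \<subseteq> {..n} \<and> (\<forall>i. i \<notin> J \<longrightarrow> 0 \<le> Poly_Mapping.lookup e i) \<and> tdeg e = m"
    if e: "e \<in> Poly_Mapping.keys (homotopy n f J)" for e
  proof -
    let ?v = "pivot e"
    have v: "?v \<in> {..n} - J" and nz: "Poly_Mapping.lookup (f (insert ?v J)) e \<noteq> 0"
      using in_keys_iff[THEN iffD1, OF e] unfolding lookup_homotopy by (auto split: if_splits)
    from nz have "e \<in> Poly_Mapping.keys (f (insert ?v J))" by (rule in_keys_iff[THEN iffD2])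
    then have "Poly_Mapping.keys e \<subseteq> {..n}" "tdeg e = m"
        "\<And>i. i \<notin> insert ?v J \<Longrightarrow> 0 \<le> Poly_Mapping.lookup e i"
      using f[OF v] by (simp_all add: laurent_part_def laurent_def of_degree_def)
    then show ?thesis using pivot_nonneg[of e] by (metis insertE)
  qed
  then show ?thesis by (simp add: laurent_part_def laurent_def of_degree_def)
qed

lemma cech_indexD:
  assumes "J \<in> cech_index {..n} p"
  shows "finite J" "J \<noteq> {}" "J \<subseteq> {..n}" "card J = Suc p"
  using assms by (auto simp: cech_index_def)

lemma cech_index_insert:
  assumes "J \<in> cech_index {..n} p" "v \<in> {..n} - J"
  shows "insert v J \<in> cech_index {..n} (Suc p)"
  using assms by (auto simp: cech_index_def)

lemma cech_index_remove:
  assumes "J \<in> cech_index {..n} (Suc p)" "j \<in> J"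
  shows "J - {j} \<in> cech_index {..n} p"
  using assms by (auto simp: cech_index_def)

lemma delta_homotopy:
  fixes f :: "nat set \<Rightarrow> 'a::{comm_ring,comm_monoid_mult} rpoly"
  assumes J: "J \<in> cech_index {..n} p" and "p < n"
    and f: "\<And>J. J \<in> cech_index {..n} p \<Longrightarrow> f J \<in> laurent_part n m J"
    and cocycle: "\<And>J. J \<in> cech_index {..n} (Suc p) \<Longrightarrow> delta f J = 0"
  shows "delta (homotopy n f) J = f J"
proof (rule poly_mapping_eqI)
  fix e
  let ?v = "pivot e" and ?F = "\<lambda>K. Poly_Mapping.lookup (f K) e"
  note J' = cech_indexD[OF J]
  show "Poly_Mapping.lookup (delta (homotopy n f) J) e = Poly_Mapping.lookup (f J) e"
  proof (cases "?v \<le> n")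
    case True
    have "Poly_Mapping.lookup (delta (homotopy n f) J) e
        = delta (\<lambda>K. if ?v \<in> K then 0 else signed ?v K (?F (insert ?v K))) J"
      unfolding lookup_delta lookup_homotopy using True by (intro arg_cong2[of _ _ _ _ delta]) auto
    also have "\<dots> = ?F J"
    proof (rule contracting_homotopy[OF J'(1)])
      assume "?v \<notin> J"
      then have "insert ?v J \<in> cech_index {..n} (Suc p)" using True by (intro cech_index_insert[OF J]) simp
      then show "delta ?F (insert ?v J) = 0" using cocycle lookup_delta[of f _ e] by (metis lookup_zero)
    qed
    finally show ?thesis .
  next
    case False
    have "e \<notin> Poly_Mapping.keys (f J)"
    proof
      assume e: "e \<in> Poly_Mapping.keys (f J)"
      have "{..n} \<subseteq> J"
      proof
        fix i assume "i \<in> {..n}"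
        then have "\<not> 0 \<le> Poly_Mapping.lookup e i" using pivot_le[of e i] False by auto
        then show "i \<in> J" using f[OF J] e by (auto simp: laurent_part_def laurent_def)
      qed
      \<comment> \<open>\<open>J\<close> has \<open>p + 1 \<le> n\<close> members, one too few to
        contain \<open>{..n}\<close>. This is where degree \<open>n\<close> is excluded.\<close>
      then have "card {..n} \<le> card J" using J'(1) by (intro card_mono)
      then show False using J'(4) \<open>p < n\<close> by simp
    qed
    then have "Poly_Mapping.lookup (f J) e = 0" by (simp add: in_keys_iff)
    moreover have "Poly_Mapping.lookup (delta (homotopy n f) J) e = 0"
      unfolding lookup_delta lookup_homotopy using False by (simp add: delta_def)
    ultimately show ?thesis by simp
  qed
qed

subsection \<open>Transport to the sheaf\<close>

definition section_of ::
  "nat \<Rightarrow> rat \<Rightarrow> nat set \<Rightarrow> 'a::{comm_ring,comm_monoid_mult} rpoly \<Rightarrow> 'a rpoly set \<Rightarrow> 'a fraction_class"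
where
  "section_of n m J f = (\<lambda>p\<in>D_mono n J. germ n m f p)"

definition laurent_group :: "nat \<Rightarrow> rat \<Rightarrow> nat set \<Rightarrow> 'a::{comm_ring,comm_monoid_mult} rpoly monoid" where
  "laurent_group n m J = \<lparr>carrier = laurent_part n m J, monoid.mult = (+), one = 0\<rparr>"

lemma laurent_part_0 [simp]: "0 \<in> laurent_part n m J"
  by (simp add: laurent_part_def)

lemma laurent_part_add: "f \<in> laurent_part n m J \<Longrightarrow> g \<in> laurent_part n m J \<Longrightarrow> f + g \<in> laurent_part n m J"
  by (simp add: laurent_part_def laurent_add of_degree_add)

lemma laurent_part_uminus: "f \<in> laurent_part n m J \<Longrightarrow> - f \<in> laurent_part n m J"
  using of_degree_diff[of m 0 f] by (simp add: laurent_part_def laurent_uminus)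

lemma laurent_part_signed: "f \<in> laurent_part n m J \<Longrightarrow> signed j K f \<in> laurent_part n m J"
  by (simp add: signed_def laurent_part_uminus)

lemma laurent_part_sum:
  "(\<And>i. i \<in> A \<Longrightarrow> f i \<in> laurent_part n m J) \<Longrightarrow> sum f A \<in> laurent_part n m J"
  by (induction A rule: infinite_finite_induct) (simp_all add: laurent_part_add)

lemma laurent_part_mono: "J \<subseteq> K \<Longrightarrow> f \<in> laurent_part n m J \<Longrightarrow> f \<in> laurent_part n m K"
  using laurent_mono[of J K n] by (auto simp: laurent_part_def)

lemma laurent_part_delta:
  assumes "\<And>j. j \<in> J \<Longrightarrow> f (J - {j}) \<in> laurent_part n m (J - {j})"
  shows "delta f J \<in> laurent_part n m J"
  unfolding delta_def
  by (intro laurent_part_sum laurent_part_signed laurent_part_mono[OF Diff_subset assms])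

lemma comm_group_laurent_group: "comm_group (laurent_group n m J)"
proof (rule comm_groupI)
  fix f assume "f \<in> carrier (laurent_group n m J)"
  then show "\<exists>g\<in>carrier (laurent_group n m J). g \<otimes>\<^bsub>laurent_group n m J\<^esub> f = \<one>\<^bsub>laurent_group n m J\<^esub>"
    by (intro bexI[of _ "- f"]) (simp_all add: laurent_group_def laurent_part_uminus)
qed (simp_all add: laurent_group_def laurent_part_add ac_simps)

text \<open>\<open>germ\<close> does not depend on the index set, so restriction keeps the same
  Laurent polynomial once D_+(X_J) is seen to lie in D_+(X_K), by X_J = X_(J-K) X_K.\<close>

lemma restrict_section_of:
  assumes "finite J" "J \<subseteq> {..n}" "K \<subseteq> J"
  shows "restrict (section_of n m K f) (D_mono n J) = section_of n m J (f :: 'a::{comm_ring,comm_monoid_mult} rpoly)"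
proof -
  have "D_mono n J \<subseteq> (D_mono n K :: 'a rpoly set set)"
  proof
    fix p :: "'a rpoly set" assume p: "p \<in> D_mono n J"
    have fin: "finite K" using assms(1,3) by (rule finite_subset[rotated])
    have "mono_pow J 1 = mono_pow (J - K) 1 * (mono_pow K 1 :: 'a rpoly)"
      using assms(1,3) fin sum.subset_diff[OF assms(3,1), of "\<lambda>j. Poly_Mapping.single j (1::rat)"]
      by (simp add: mono_pow_def mult_single)
    moreover have "(mono_pow (J - K) 1 :: 'a rpoly) \<in> laurent n {}" "(mono_pow K 1 :: 'a rpoly) \<in> laurent n {}"
      using assms fin by (auto intro!: mono_pow_ratpoly)
    ultimately show "p \<in> D_mono n K"
      using p Proj_notin_mult[of p n "mono_pow (J - K) 1" "mono_pow K 1"] by (simp add: D_mono_def)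
  qed
  then show ?thesis by (auto simp: section_of_def restrict_def fun_eq_iff)
qed

section \<open>The group of sections over one intersection of the cover\<close>

context
  fixes n :: nat and m :: rat and J :: "nat set"
    and F :: "('a::{comm_ring,comm_monoid_mult} rpoly set \<Rightarrow> 'a fraction_class) monoid"
  assumes J: "finite J" "J \<noteq> {}" "J \<subseteq> {..n}"
  defines "F \<equiv> O_twist n m (\<Inter>j\<in>J. Dplus n (Xvar j))"
begin

lemma F_eq: "F = O_twist n m (D_mono n J)"
  unfolding F_def Inter_Dplus_eq_D_mono[OF J] ..

lemma carrier_F: "carrier F = section_of n m J ` laurent_part n m J"
proof
  show "carrier F \<subseteq> section_of n m J ` laurent_part n m J"
  proof
    fix \<sigma> assume "\<sigma> \<in> carrier F"
    then obtain f where "f \<in> laurent n J" "of_degree m f" "\<sigma> = section_of n m J f"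
      using germ_section_surj[OF J] unfolding F_eq section_of_def by metis
    then show "\<sigma> \<in> section_of n m J ` laurent_part n m J" by (simp add: laurent_part_def)
  qed
  show "section_of n m J ` laurent_part n m J \<subseteq> carrier F"
    using germ_section_carrier[OF J(1,3)] by (auto simp: F_eq section_of_def laurent_part_def)
qed

lemma section_of_in_carrier: "f \<in> laurent_part n m J \<Longrightarrow> section_of n m J f \<in> carrier F"
  by (simp add: carrier_F)

lemma section_of_inj: "inj_on (section_of n m J :: 'a rpoly \<Rightarrow> _) (laurent_part n m J)"
proof (rule inj_onI)
  fix f g :: "'a rpoly"
  assume fg: "f \<in> laurent_part n m J" "g \<in> laurent_part n m J" and eq: "section_of n m J f = section_of n m J g"
  have "germ n m f p = germ n m g p" if "p \<in> D_mono n J" for p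
    using fun_cong[OF eq, of p] that by (simp add: section_of_def)
  then show "f = g"
    using germ_section_inj[OF J, of f m g] fg by (simp add: laurent_part_def)
qed

lemma section_of_mult:
  assumes "f \<in> laurent_part n m J" "g \<in> laurent_part n m J"
  shows "section_of n m J f \<otimes>\<^bsub>F\<^esub> section_of n m J g = section_of n m J (f + g)"
proof -
  have "stalk_add n (twist n m) p (germ n m f p) (germ n m g p) = germ n m (f + g) p"
    if "p \<in> D_mono n J" for p
    using assms germ_nonempty[OF J(1,3) _ _ that] that
    by (intro stalk_add_germ) (simp_all add: laurent_part_def D_mono_def)
  then show ?thesis
    by (simp add: F_eq O_twist_def assoc_sheaf_def section_of_def cong: restrict_cong)
qed

lemma section_of_0: "section_of n m J 0 = \<one>\<^bsub>F\<^esub>"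
  using germ_zero by (auto simp: F_eq O_twist_def assoc_sheaf_def section_of_def D_mono_def fun_eq_iff restrict_def)

lemma section_of_hom: "section_of n m J \<in> hom (laurent_group n m J) F"
  by (rule homI) (simp_all add: laurent_group_def section_of_in_carrier section_of_mult)

text \<open>The group laws are carried over from Laurent polynomials: \<open>F\<close> is the image
  of the homomorphism \<open>section_of\<close>, by \<open>carrier_F\<close> and
  \<open>section_of_0\<close>.\<close>

lemma comm_group_F: "comm_group F"
proof -
  have "comm_group (F\<lparr>carrier := section_of n m J ` carrier (laurent_group n m J),
      one := section_of n m J \<one>\<^bsub>laurent_group n m J\<^esub>\<rparr>)"
    by (rule comm_group.hom_imp_img_comm_group[OF comm_group_laurent_group section_of_hom])
  then show ?thesis by (simp add: laurent_group_def section_of_0 flip: carrier_F)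
qed

interpretation F: comm_group F by (rule comm_group_F)

lemma section_of_uminus:
  assumes "f \<in> laurent_part n m J"
  shows "section_of n m J (- f) = inv\<^bsub>F\<^esub> section_of n m J f"
proof -
  have "section_of n m J (- f) \<otimes>\<^bsub>F\<^esub> section_of n m J f = \<one>\<^bsub>F\<^esub>"
    using section_of_mult[OF laurent_part_uminus[OF assms] assms] section_of_0 by simp
  then show ?thesis
    using F.inv_equality[OF _ section_of_in_carrier[OF assms] section_of_in_carrier[OF laurent_part_uminus[OF assms]]]
    by simp
qed

text \<open>In the multiplicative record the Cech sign is an integer exponent 1 or -1, that is, the
  identity or the inverse.\<close>

lemma section_of_signed:
  assumes "f \<in> laurent_part n m J"
  shows "section_of n m J f [^]\<^bsub>F\<^esub> ((-1) ^ card {i\<in>K. i < j} :: int) = section_of n m J (signed j K f)"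
proof (cases "even (card {i\<in>K. i < j})")
  case True
  then show ?thesis using section_of_in_carrier[OF assms] by (simp add: signed_def)
next
  case False
  then have "section_of n m J f [^]\<^bsub>F\<^esub> ((-1) ^ card {i\<in>K. i < j} :: int) = section_of n m J f [^]\<^bsub>F\<^esub> (- 1 :: int)"
    by simp
  also have "\<dots> = inv\<^bsub>F\<^esub> (section_of n m J f)"
    using F.int_pow_neg[OF section_of_in_carrier[OF assms], of 1] F.int_pow_1[OF section_of_in_carrier[OF assms]]
    by simp
  finally show ?thesis using False by (simp add: signed_def section_of_uminus[OF assms])
qed

lemma section_of_finprod:
  assumes "finite A" "\<And>i. i \<in> A \<Longrightarrow> f i \<in> laurent_part n m J"
  shows "finprod F (\<lambda>i. section_of n m J (f i)) A = section_of n m J (sum f A)"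
  using assms
proof (induction A rule: finite_induct)
  case empty
  then show ?case by (simp add: section_of_0)
next
  case (insert i A)
  have "finprod F (\<lambda>i. section_of n m J (f i)) (insert i A)
      = section_of n m J (f i) \<otimes>\<^bsub>F\<^esub> finprod F (\<lambda>i. section_of n m J (f i)) A"
    using insert section_of_in_carrier by (intro F.finprod_insert) auto
  also have "\<dots> = section_of n m J (sum f (insert i A))"
    using insert section_of_mult[of "f i" "sum f A"] laurent_part_sum[of A f] by simp
  finally show ?case .
qed

end

section \<open>Cochains, cocycles and coboundaries in terms of Laurent polynomials\<close>

definition cochain_of ::
  "nat \<Rightarrow> rat \<Rightarrow> nat \<Rightarrow> (nat set \<Rightarrow> 'a::{comm_ring,comm_monoid_mult} rpoly)
     \<Rightarrow> nat set \<Rightarrow> 'a rpoly set \<Rightarrow> 'a fraction_class"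
where
  "cochain_of n m p f = (\<lambda>J\<in>cech_index {..n} p. section_of n m J (f J))"

definition laurent_cochains ::
  "nat \<Rightarrow> rat \<Rightarrow> nat \<Rightarrow> (nat set \<Rightarrow> 'a::{comm_ring,comm_monoid_mult} rpoly) set"
where
  "laurent_cochains n m p = {f. \<forall>J\<in>cech_index {..n} p. f J \<in> laurent_part n m J}"

abbreviation cech_group where
  "cech_group n m p \<equiv> cech_cochains {..n} (O_twist n m) (\<lambda>j. Dplus n (Xvar j)) p"

abbreviation cech_d where
  "cech_d n m p \<equiv> cech_coboundary {..n} (O_twist n m) (\<lambda>j. Dplus n (Xvar j)) p"

lemma carrier_cech_group:
  "carrier (cech_group n m p) =
     (cochain_of n m p ` laurent_cochains n m p
       :: (nat set \<Rightarrow> 'a::{comm_ring,comm_monoid_mult} rpoly set \<Rightarrow> 'a fraction_class) set)"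
  (is "?C = ?R")
proof
  show "?R \<subseteq> ?C"
    by (auto simp: cech_cochains_def cochain_of_def laurent_cochains_def
        intro!: section_of_in_carrier cech_indexD)
  show "?C \<subseteq> ?R"
  proof
    fix x assume "x \<in> ?C"
    then have x: "x \<in> (\<Pi>\<^sub>E J\<in>cech_index {..n} p. carrier (O_twist n m (\<Inter>j\<in>J. Dplus n (Xvar j))))"
      by (simp add: cech_cochains_def)
    have "\<exists>f. f \<in> laurent_part n m J \<and> x J = section_of n m J f" if J: "J \<in> cech_index {..n} p" for J
      using PiE_mem[OF x J] unfolding carrier_F[OF cech_indexD(1-3)[OF J]] by blast
    then obtain f where f: "\<And>J. J \<in> cech_index {..n} p \<Longrightarrow> f J \<in> laurent_part n m J \<and> x J = section_of n m J (f J)"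
      by metis
    have "x = cochain_of n m p f"
      unfolding cochain_of_def using x f
      by (intro extensionalityI[of _ "cech_index {..n} p"]) (simp_all add: PiE_iff)
    moreover have "f \<in> laurent_cochains n m p" using f by (simp add: laurent_cochains_def)
    ultimately show "x \<in> ?R" by blast
  qed
qed

lemma cochain_of_0: "cochain_of n m p (\<lambda>_. 0) = \<one>\<^bsub>cech_group n m p\<^esub>"
  unfolding cochain_of_def cech_cochains_def one_product_group
  by (intro restrict_ext section_of_0 cech_indexD)

lemma cochain_of_mult:
  assumes "f \<in> laurent_cochains n m p" "g \<in> laurent_cochains n m p"
  shows "cochain_of n m p f \<otimes>\<^bsub>cech_group n m p\<^esub> cochain_of n m p g = cochain_of n m p (\<lambda>J. f J + g J)"
proof -
  have "section_of n m J (f J) \<otimes>\<^bsub>O_twist n m (\<Inter>j\<in>J. Dplus n (Xvar j))\<^esub> section_of n m J (g J)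
      = section_of n m J (f J + g J)" if "J \<in> cech_index {..n} p" for J
    using assms that by (intro section_of_mult cech_indexD[OF that]) (simp_all add: laurent_cochains_def)
  then show ?thesis
    unfolding cochain_of_def cech_cochains_def mult_product_group by (intro restrict_ext) simp
qed

text \<open>Members of \<open>laurent_cochains\<close> are unconstrained outside
  \<open>cech_index\<close>, so injectivity of \<open>section_of\<close> gives uniqueness on the
  index set only.\<close>

lemma cochain_of_eq_iff:
  assumes "f \<in> laurent_cochains n m p" "g \<in> laurent_cochains n m p"
  shows "cochain_of n m p f = cochain_of n m p g \<longleftrightarrow> (\<forall>J\<in>cech_index {..n} p. f J = g J)"
proof
  assume eq: "cochain_of n m p f = cochain_of n m p g"
  show "\<forall>J\<in>cech_index {..n} p. f J = g J"
  proof
    fix J assume J: "J \<in> cech_index {..n} p"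
    then have "section_of n m J (f J) = section_of n m J (g J)"
      using fun_cong[OF eq, of J] by (simp add: cochain_of_def)
    then show "f J = g J"
      by (rule inj_onD[OF section_of_inj[OF cech_indexD(1-3)[OF J]]])
         (use assms J in \<open>simp_all add: laurent_cochains_def\<close>)
  qed
next
  assume "\<forall>J\<in>cech_index {..n} p. f J = g J"
  then show "cochain_of n m p f = cochain_of n m p g" unfolding cochain_of_def by (intro restrict_ext) simp
qed

lemma delta_laurent_cochains:
  assumes "f \<in> laurent_cochains n m p"
  shows "delta f \<in> laurent_cochains n m (Suc p)"
proof -
  have "delta f J \<in> laurent_part n m J" if J: "J \<in> cech_index {..n} (Suc p)" for J
    using assms cech_index_remove[OF J] by (intro laurent_part_delta) (simp add: laurent_cochains_def)
  then show ?thesis by (simp add: laurent_cochains_def)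
qed

text \<open>\<open>cochain_of\<close> is a map of complexes: restrictions become inclusions,
  exponents become signs, and \<open>finprod\<close> becomes a sum.\<close>

lemma cech_d_cochain_of:
  fixes f :: "nat set \<Rightarrow> 'a::{comm_ring,comm_monoid_mult} rpoly"
  assumes "f \<in> laurent_cochains n m p"
  shows "cech_d n m p (cochain_of n m p f) = cochain_of n m (Suc p) (delta f)"
  unfolding cech_coboundary_def cochain_of_def[of n m "Suc p"]
proof (rule restrict_ext)
  fix J assume J: "J \<in> cech_index {..n} (Suc p)"
  note J' = cech_indexD(1-3)[OF J]
  let ?F = "O_twist n m (\<Inter>j\<in>J. Dplus n (Xvar j)) :: ('a rpoly set \<Rightarrow> 'a fraction_class) monoid"
  interpret F: comm_group ?F by (rule comm_group_F[OF J'])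
  have mem: "signed j J (f (J - {j})) \<in> laurent_part n m J" if "j \<in> J" for j
    using assms cech_index_remove[OF J that]
    by (intro laurent_part_signed laurent_part_mono[OF Diff_subset[of J "{j}"]]) (simp add: laurent_cochains_def)
  have summand: "restrict (cochain_of n m p f (J - {j})) (\<Inter>j\<in>J. Dplus n (Xvar j))
      [^]\<^bsub>?F\<^esub> ((-1) ^ card {i\<in>J. i < j} :: int) = section_of n m J (signed j J (f (J - {j})))"
    if "j \<in> J" for j
  proof -
    have fj: "f (J - {j}) \<in> laurent_part n m J"
      using assms cech_index_remove[OF J that]
      by (intro laurent_part_mono[OF Diff_subset[of J "{j}"]]) (simp add: laurent_cochains_def)
    have "restrict (cochain_of n m p f (J - {j})) (\<Inter>j\<in>J. Dplus n (Xvar j)) = section_of n m J (f (J - {j}))"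
      unfolding Inter_Dplus_eq_D_mono[OF J'] cochain_of_def
      using cech_index_remove[OF J that] restrict_section_of[OF J'(1,3) Diff_subset[of J "{j}"]] by simp
    then show ?thesis by (simp only: section_of_signed[OF J' fj])
  qed
  have "finprod ?F (\<lambda>j. restrict (cochain_of n m p f (J - {j})) (\<Inter>j\<in>J. Dplus n (Xvar j))
      [^]\<^bsub>?F\<^esub> ((-1) ^ card {i\<in>J. i < j} :: int)) J
    = finprod ?F (\<lambda>j. section_of n m J (signed j J (f (J - {j})))) J"
    by (rule F.finprod_cong'[OF refl]) (simp_all add: summand section_of_in_carrier[OF J'] mem Pi_def)
  also have "\<dots> = section_of n m J (delta f J)"
    unfolding delta_def by (rule section_of_finprod[OF J' J'(1) mem])
  finally show "finprod ?F (\<lambda>j. restrict (cochain_of n m p f (J - {j})) (\<Inter>j\<in>J. Dplus n (Xvar j))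
      [^]\<^bsub>?F\<^esub> ((-1) ^ card {i\<in>J. i < j} :: int)) J = section_of n m J (delta f J)" .
qed

lemma cech_cocycles_eq:
  "cech_cocycles {..n} (O_twist n m) (\<lambda>j. Dplus n (Xvar j)) p =
     (cochain_of n m p ` {f \<in> laurent_cochains n m p. \<forall>J\<in>cech_index {..n} (Suc p). delta f J = 0}
       :: (nat set \<Rightarrow> 'a::{comm_ring,comm_monoid_mult} rpoly set \<Rightarrow> 'a fraction_class) set)"
proof -
  have "cech_d n m p (cochain_of n m p f) = \<one>\<^bsub>cech_group n m (Suc p)\<^esub>
      \<longleftrightarrow> (\<forall>J\<in>cech_index {..n} (Suc p). delta f J = 0)"
    if "f \<in> laurent_cochains n m p" for f :: "nat set \<Rightarrow> 'a rpoly"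
    using cochain_of_eq_iff[OF delta_laurent_cochains[OF that], of "\<lambda>_. 0"]
    by (simp add: cech_d_cochain_of[OF that] laurent_cochains_def flip: cochain_of_0)
  then show ?thesis
    unfolding cech_cocycles_def kernel_def carrier_cech_group by auto
qed

text \<open>One inclusion is \<open>delta_delta\<close>; for the other, \<open>homotopy n f\<close>
  is a preimage of the cocycle \<open>f\<close>. \<open>0 < p\<close> provides the degree
  \<open>q\<close> in which it lives.\<close>

lemma cocycles_eq_coboundaries:
  assumes "0 < p" "p < n"
  shows "cech_coboundaries {..n} (O_twist n m) (\<lambda>j. Dplus n (Xvar j)) p =
     (cech_cocycles {..n} (O_twist n m) (\<lambda>j. Dplus n (Xvar j)) p
       :: (nat set \<Rightarrow> 'a::{comm_ring,comm_monoid_mult} rpoly set \<Rightarrow> 'a fraction_class) set)"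
  (is "?B = ?Z")
proof -
  obtain q where p: "p = Suc q" using assms(1) by (cases p) auto
  have B: "?B = cech_d n m q ` cochain_of n m q ` laurent_cochains n m q"
    unfolding cech_coboundaries_def p by (simp add: carrier_cech_group)
  show ?thesis
  proof
    show "?B \<subseteq> ?Z"
    proof
      fix x assume "x \<in> ?B"
      then obtain g where g: "g \<in> laurent_cochains n m q" "x = cech_d n m q (cochain_of n m q g)"
        unfolding B by blast
      have "delta (delta g) J = 0" if "J \<in> cech_index {..n} (Suc p)" for J
        using cech_indexD(1)[OF that] by (rule delta_delta)
      then show "x \<in> ?Z"
        using delta_laurent_cochains[OF g(1)]
        unfolding cech_cocycles_eq g(2) cech_d_cochain_of[OF g(1)] p by blast
    qed
    show "?Z \<subseteq> ?B"
    proof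
      fix x assume "x \<in> ?Z"
      then obtain f where f: "f \<in> laurent_cochains n m p" "x = cochain_of n m p f"
        and cocycle: "\<And>J. J \<in> cech_index {..n} (Suc p) \<Longrightarrow> delta f J = 0"
        unfolding cech_cocycles_eq by blast
      have fJ: "f J \<in> laurent_part n m J" if "J \<in> cech_index {..n} p" for J
        using f(1) that by (simp add: laurent_cochains_def)
      have h: "homotopy n f \<in> laurent_cochains n m q"
        unfolding laurent_cochains_def
      proof (intro CollectI ballI homotopy_laurent_part fJ)
        fix J v assume "J \<in> cech_index {..n} q" "v \<in> {..n} - J"
        then show "insert v J \<in> cech_index {..n} p" unfolding p by (rule cech_index_insert)
      qed
      have "cochain_of n m p (delta (homotopy n f)) = x"
        unfolding f(2) cochain_of_def
        by (intro restrict_ext arg_cong[of _ _ "section_of n m _"] delta_homotopy[OF _ assms(2) fJ cocycle])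
      then show "x \<in> ?B"
        unfolding B using cech_d_cochain_of[OF h] h unfolding p by (intro image_eqI) simp_all
    qed
  qed
qed

section \<open>Triviality of the quotient group\<close>

lemma trivial_group_Mod_self:
  assumes "group G"
  shows "trivial_group (G Mod carrier G)"
proof -
  interpret group G by fact
  have "subgroup (carrier G) G" by (rule subgroup_self)
  then have "carrier G #>\<^bsub>G\<^esub> a = carrier G" if "a \<in> carrier G" for a
    using that by (intro coset_join2)
  then have "carrier (G Mod carrier G) = {carrier G}"
    unfolding FactGroup_def RCOSETS_def by auto
  moreover have "carrier G \<lhd> G"
    by (simp add: normal_inv_iff subgroup_self)
  then have "group (G Mod carrier G)" by (rule normal.factorgroup_is_group)
  ultimately show ?thesis by (simp add: trivial_group_def FactGroup_def)
qed

text \<open>Needed for the quotient to be formed inside a group. Closure is checked on Laurent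
  polynomials, where \<open>delta\<close> is visibly additive.\<close>

lemma subgroup_cech_cocycles:
  "subgroup (cech_cocycles {..n} (O_twist n m) (\<lambda>j. Dplus n (Xvar j)) p)
     (cech_group n m p :: (nat set \<Rightarrow> 'a::{comm_ring,comm_monoid_mult} rpoly set \<Rightarrow> 'a fraction_class) monoid)"
  (is "subgroup ?Z ?G")
proof -
  have "group ?G"
    unfolding cech_cochains_def
    by (simp add: comm_group.axioms(2)[OF comm_group_F[OF cech_indexD(1-3)]])
  then interpret group ?G .
  show ?thesis
  proof (rule subgroup.intro)
    show "?Z \<subseteq> carrier ?G" unfolding cech_cocycles_eq carrier_cech_group by auto
    show "\<one>\<^bsub>?G\<^esub> \<in> ?Z"
      unfolding cech_cocycles_eq cochain_of_0[symmetric]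
      by (rule imageI) (simp add: laurent_cochains_def delta_def)
  next
    fix x y assume "x \<in> ?Z" "y \<in> ?Z"
    then obtain f g where f: "f \<in> laurent_cochains n m p" "x = cochain_of n m p f"
        "\<And>J. J \<in> cech_index {..n} (Suc p) \<Longrightarrow> delta f J = 0"
      and g: "g \<in> laurent_cochains n m p" "y = cochain_of n m p g"
        "\<And>J. J \<in> cech_index {..n} (Suc p) \<Longrightarrow> delta g J = 0"
      unfolding cech_cocycles_eq by blast
    have "delta (\<lambda>J. f J + g J) J = delta f J + delta g J" for J
      by (simp add: delta_def signed_add sum.distrib)
    then show "x \<otimes>\<^bsub>?G\<^esub> y \<in> ?Z"
      unfolding f(2) g(2) cochain_of_mult[OF f(1) g(1)] cech_cocycles_eq
      using f(1,3) g(1,3) by (intro imageI) (simp add: laurent_cochains_def laurent_part_add)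
  next
    fix x assume "x \<in> ?Z"
    then obtain f where f: "f \<in> laurent_cochains n m p" "x = cochain_of n m p f"
        "\<And>J. J \<in> cech_index {..n} (Suc p) \<Longrightarrow> delta f J = 0"
      unfolding cech_cocycles_eq by blast
    have g: "(\<lambda>J. - f J) \<in> laurent_cochains n m p"
      using f(1) by (simp add: laurent_cochains_def laurent_part_uminus)
    have "delta (\<lambda>J. - f J) J = - delta f J" for J
      by (simp add: delta_def signed_minus sum_negf)
    then have "cochain_of n m p (\<lambda>J. - f J) \<in> ?Z"
      unfolding cech_cocycles_eq using g f(3) by (intro imageI) simp
    moreover have "inv\<^bsub>?G\<^esub> x = cochain_of n m p (\<lambda>J. - f J)"
    proof (rule inv_equality)
      show "cochain_of n m p (\<lambda>J. - f J) \<otimes>\<^bsub>?G\<^esub> x = \<one>\<^bsub>?G\<^esub>"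
        unfolding f(2) cochain_of_mult[OF g f(1)] by (simp flip: cochain_of_0)
      show "x \<in> carrier ?G" unfolding f(2) carrier_cech_group using f(1) by (rule imageI)
      show "cochain_of n m p (\<lambda>J. - f J) \<in> carrier ?G" unfolding carrier_cech_group using g by (rule imageI)
    qed
    ultimately show "inv\<^bsub>?G\<^esub> x \<in> ?Z" by simp
  qed
qed

theorem mainTheorem6:
  fixes n i :: nat and m :: rat
  assumes "0 < n" and "0 < i" and "i < n"
  shows "trivial_group (Proj_cohomology i n m ::
    (nat set \<Rightarrow> 'a::{comm_ring,comm_monoid_mult} rpoly set \<Rightarrow> 'a fraction_class) set monoid)"
proof -
  let ?G = "cech_group n m i :: (nat set \<Rightarrow> 'a rpoly set \<Rightarrow> 'a fraction_class) monoid"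
  let ?Z = "cech_cocycles {..n} (O_twist n m) (\<lambda>j. Dplus n (Xvar j)) i
    :: (nat set \<Rightarrow> 'a rpoly set \<Rightarrow> 'a fraction_class) set"
  have "group ?G"
    unfolding cech_cochains_def
    by (simp add: comm_group.axioms(2)[OF comm_group_F[OF cech_indexD(1-3)]])
  with subgroup_cech_cocycles have "group (?G\<lparr>carrier := ?Z\<rparr>)"
    by (rule subgroup.subgroup_is_group)
  \<comment> \<open>The coboundaries are all of \<open>?Z\<close>, so the cohomology is the quotient
    of the cocycle group by its full carrier.\<close>
  then have "trivial_group (?G\<lparr>carrier := ?Z\<rparr> Mod carrier (?G\<lparr>carrier := ?Z\<rparr>))"
    by (rule trivial_group_Mod_self)
  then show ?thesis
    by (simp add: Proj_cohomology_def cech_cohomology_def cocycles_eq_coboundaries[OF assms(2,3)])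
qed

end
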